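(* Let $t$ be a nonnegative integer, and let $G$ be a sparse-dense graph with respect to classes $\mathcal S$ (sparse) and $\mathcal D$ (dense), such that $\mathcal D$ is a subclass of the class of $\overline{K_t}$-free graphs, and $\mathcal S$ is a graph class that is recognizable in $T_1(n)$ time on $n$-vertex graphs and for whose $n$-vertex members a maximum independent set can be found in $T_2(n)$ time. Then a maximum independent set of $G$ can be found in $(T_1(n)+T_2(n))\cdot n^{\mathcal{O}(t)}$ time, where $n=|V(G)|$.
   Context: Graphs are finite, simple and undirected. Classes $\mathcal S$ and $\mathcal D$ of graphs are called classes of sparse and dense graphs, respectively, if both are closed under taking induced subgraphs and there is a constant $c$ (depending only on the two fixed classes) such that $|S\cap D|\le c$ for any $S\in\mathcal S$ and $D\in\mathcal D$ (here $S$, $D$ are identified with vertex subsets, of a common graph, inducing graphs in the respective class). A sparse-dense partition of a graph $G$ with respect to $\mathcal S$ and $\mathcal D$ is a partition $V(G)=S\cup D$ into two disjoint parts such that $S\in\mathcal S$ and $D\in\mathcal D$ (i.e., the induced subgraphs $G[S]$, $G[D]$ belong to $\mathcal S$, $\mathcal D$). A graph admitting such a partition is called a sparse-dense graph with respect to $\mathcal S$ and $\mathcal D$. A graph is $\overline{K_t}$-free if it has no independent set of size $t$ (equivalently, its complement is $K_t$-free). A maximum independent set is an independent set of largest cardinality. The input of the algorithm is the graph $G$; no sparse-dense partition is given.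
   Formalization: The time bounds T_1 and T_2 are assumed nondecreasing, since the algorithms for the sparse class are run on smaller induced subgraphs; for arbitrary T_1, T_2 the claim fails (assuming P ≠ NP). *)

theory Defs
  imports Main
begin

section \<open>Graphs and graph classes\<close>

datatype ugraph = Graph (verts: "nat set") (edges: "nat set set")

definition simple_graph :: "ugraph \<Rightarrow> bool" where
  "simple_graph G \<longleftrightarrow> finite (verts G) \<and> (\<forall>e\<in>edges G. e \<subseteq> verts G \<and> card e = 2)"

definition induced :: "ugraph \<Rightarrow> nat set \<Rightarrow> ugraph" where
  "induced G A = Graph (verts G \<inter> A) {e \<in> edges G. e \<subseteq> A}"

definition isomorphic :: "ugraph \<Rightarrow> ugraph \<Rightarrow> bool" where
  "isomorphic G H \<longleftrightarrow> (\<exists>f. bij_betw f (verts G) (verts H) \<and>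
     (\<forall>u\<in>verts G. \<forall>v\<in>verts G. {u, v} \<in> edges G \<longleftrightarrow> {f u, f v} \<in> edges H))"

definition graph_class :: "ugraph set \<Rightarrow> bool" where
  "graph_class C \<longleftrightarrow> (\<forall>G\<in>C. simple_graph G) \<and>
     (\<forall>G\<in>C. \<forall>H. simple_graph H \<and> isomorphic G H \<longrightarrow> H \<in> C)"

definition hereditary :: "ugraph set \<Rightarrow> bool" where
  "hereditary C \<longleftrightarrow> (\<forall>G\<in>C. \<forall>A\<subseteq>verts G. induced G A \<in> C)"

definition sparse_dense_classes :: "nat \<Rightarrow> ugraph set \<Rightarrow> ugraph set \<Rightarrow> bool" where
  "sparse_dense_classes c \<S> \<D> \<longleftrightarrow>
     graph_class \<S> \<and> graph_class \<D> \<and> hereditary \<S> \<and> hereditary \<D> \<and>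
     (\<forall>G S D. simple_graph G \<and> S \<subseteq> verts G \<and> D \<subseteq> verts G \<and>
        induced G S \<in> \<S> \<and> induced G D \<in> \<D> \<longrightarrow> card (S \<inter> D) \<le> c)"

definition sparse_dense_partition ::
    "ugraph set \<Rightarrow> ugraph set \<Rightarrow> ugraph \<Rightarrow> nat set \<Rightarrow> nat set \<Rightarrow> bool" where
  "sparse_dense_partition \<S> \<D> G S D \<longleftrightarrow>
     S \<union> D = verts G \<and> S \<inter> D = {} \<and> induced G S \<in> \<S> \<and> induced G D \<in> \<D>"

definition sparse_dense_graphs :: "ugraph set \<Rightarrow> ugraph set \<Rightarrow> ugraph set" where
  "sparse_dense_graphs \<S> \<D> =
     {G. simple_graph G \<and> (\<exists>S D. sparse_dense_partition \<S> \<D> G S D)}"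

definition independent_set :: "ugraph \<Rightarrow> nat set \<Rightarrow> bool" where
  "independent_set G I \<longleftrightarrow> I \<subseteq> verts G \<and> (\<forall>u\<in>I. \<forall>v\<in>I. {u, v} \<notin> edges G)"

definition maximum_independent_set :: "ugraph \<Rightarrow> nat set \<Rightarrow> bool" where
  "maximum_independent_set G I \<longleftrightarrow>
     independent_set G I \<and> (\<forall>J. independent_set G J \<longrightarrow> card J \<le> card I)"

definition co_clique_free :: "nat \<Rightarrow> ugraph set" where
  "co_clique_free t =
     {G. simple_graph G \<and> \<not> (\<exists>I. independent_set G I \<and> card I = t)}"


section \<open>Algorithms and running time\<close>

text \<open>
  The machine model is the WHILE language of N. D. Jones (Computability and Complexity from
  a Programming Perspective, MIT Press 1997): imperative programs over binary trees with the
  operations nil, cons, hd and tl, and the test for being different from nil. Each elementary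
  operation takes one time unit. Jones' tree equality test is left out, so that every
  elementary operation takes constant time on a pointer machine.
\<close>

datatype tree = Nil_tree | Dot tree tree

datatype expr = Var nat | NilE | ConsE expr expr | HdE expr | TlE expr

datatype cmd = Assign nat expr | Seq cmd cmd | If expr cmd cmd | While expr cmd

type_synonym store = "nat \<Rightarrow> tree"

fun hd_tree :: "tree \<Rightarrow> tree" where
  "hd_tree Nil_tree = Nil_tree"
| "hd_tree (Dot a b) = a"

fun tl_tree :: "tree \<Rightarrow> tree" where
  "tl_tree Nil_tree = Nil_tree"
| "tl_tree (Dot a b) = b"

fun eval_expr :: "expr \<Rightarrow> store \<Rightarrow> tree" where
  "eval_expr (Var x) s = s x"
| "eval_expr NilE s = Nil_tree"
| "eval_expr (ConsE e f) s = Dot (eval_expr e s) (eval_expr f s)"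
| "eval_expr (HdE e) s = hd_tree (eval_expr e s)"
| "eval_expr (TlE e) s = tl_tree (eval_expr e s)"

fun expr_time :: "expr \<Rightarrow> nat" where
  "expr_time (Var x) = 1"
| "expr_time NilE = 1"
| "expr_time (ConsE e f) = 1 + expr_time e + expr_time f"
| "expr_time (HdE e) = 1 + expr_time e"
| "expr_time (TlE e) = 1 + expr_time e"

text \<open>\<open>exec p s k s'\<close>: started in store \<open>s\<close>, the command \<open>p\<close> halts after exactly \<open>k\<close> time units
  in store \<open>s'\<close>.\<close>

inductive exec :: "cmd \<Rightarrow> store \<Rightarrow> nat \<Rightarrow> store \<Rightarrow> bool" where
  Assign: "exec (Assign x e) s (1 + expr_time e) (s(x := eval_expr e s))"
| Seq: "exec p s k s' \<Longrightarrow> exec q s' l s'' \<Longrightarrow> exec (Seq p q) s (k + l) s''"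
| IfTrue: "eval_expr e s \<noteq> Nil_tree \<Longrightarrow> exec p s k s' \<Longrightarrow>
    exec (If e p q) s (1 + expr_time e + k) s'"
| IfFalse: "eval_expr e s = Nil_tree \<Longrightarrow> exec q s k s' \<Longrightarrow>
    exec (If e p q) s (1 + expr_time e + k) s'"
| WhileTrue: "eval_expr e s \<noteq> Nil_tree \<Longrightarrow> exec p s k s' \<Longrightarrow> exec (While e p) s' l s'' \<Longrightarrow>
    exec (While e p) s (1 + expr_time e + k + l) s''"
| WhileFalse: "eval_expr e s = Nil_tree \<Longrightarrow> exec (While e p) s (1 + expr_time e) s"

lemma exec_deterministic:
  "exec p s k s' \<Longrightarrow> exec p s l s'' \<Longrightarrow> k = l \<and> s' = s''"
proof (induction arbitrary: l s'' rule: exec.induct)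
  case (Assign x e s)
  then show ?case by (auto elim: exec.cases)
next
  case (Seq p s k s' q l' s3)
  from Seq.prems show ?case
    by (cases rule: exec.cases) (use Seq.IH in blast)
next
  case (IfTrue e s p k s' q)
  from IfTrue.prems show ?case
    by (cases rule: exec.cases) (use IfTrue in blast)+
next
  case (IfFalse e s q k s' p)
  from IfFalse.prems show ?case
    by (cases rule: exec.cases) (use IfFalse in blast)+
next
  case (WhileTrue e s p k s' l' s3)
  from WhileTrue.prems show ?case
    by (cases rule: exec.cases) (use WhileTrue in blast)+
next
  case (WhileFalse e s p)
  from WhileFalse.prems WhileFalse.hyps show ?case
    by (cases rule: exec.cases) auto
qed

text \<open>Variable 0 holds the input at the start and the output at the end; all other variables
  are initially nil.\<close>

definition runs :: "cmd \<Rightarrow> tree \<Rightarrow> tree \<Rightarrow> nat \<Rightarrow> bool" where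
  "runs p x y k \<longleftrightarrow> (\<exists>s. exec p ((\<lambda>_. Nil_tree)(0 := x)) k s \<and> s 0 = y)"

fun enc_list :: "tree list \<Rightarrow> tree" where
  "enc_list [] = Nil_tree"
| "enc_list (x # xs) = Dot x (enc_list xs)"

definition enc_bool :: "bool \<Rightarrow> tree" where
  "enc_bool b = (if b then Dot Nil_tree Nil_tree else Nil_tree)"

text \<open>Graphs are given to programs with vertex set \<open>{..<n}\<close>, as adjacency matrices; vertex sets
  are returned as characteristic vectors. Graph classes are closed under isomorphism, so the
  numbering of the vertices is no restriction.\<close>

definition enc_graph :: "nat \<Rightarrow> ugraph \<Rightarrow> tree" where
  "enc_graph n G =
     enc_list (map (\<lambda>i. enc_list (map (\<lambda>j. enc_bool ({i, j} \<in> edges G)) [0..<n])) [0..<n])"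

definition enc_set :: "nat \<Rightarrow> nat set \<Rightarrow> tree" where
  "enc_set n A = enc_list (map (\<lambda>i. enc_bool (i \<in> A)) [0..<n])"

definition recognizable_in_time :: "ugraph set \<Rightarrow> (nat \<Rightarrow> nat) \<Rightarrow> bool" where
  "recognizable_in_time C T \<longleftrightarrow>
     (\<exists>p. \<forall>n G. simple_graph G \<and> verts G = {..<n} \<longrightarrow>
        (\<exists>k. runs p (enc_graph n G) (enc_bool (G \<in> C)) k \<and> k \<le> T n))"

text \<open>Nothing is required of the program on graphs outside the class, not even termination.\<close>

definition mis_computable_in_time :: "ugraph set \<Rightarrow> (nat \<Rightarrow> nat) \<Rightarrow> bool" where
  "mis_computable_in_time C T \<longleftrightarrow>
     (\<exists>p. \<forall>n G. G \<in> C \<and> verts G = {..<n} \<longrightarrow>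
        (\<exists>I k. maximum_independent_set G I \<and> runs p (enc_graph n G) (enc_set n I) k \<and> k \<le> T n))"

end

theory Submission
  imports Defs
begin

text \<open>
  Let \<open>V(G) = S \<union> D\<close> be the unknown partition. Any \<open>S'\<close> inducing a graph of the sparse class
  meets \<open>D\<close> in at most \<open>c\<close> vertices; so if \<open>|S'| < |S|\<close>, then dropping \<open>S' - S\<close> and adding
  \<open>|S' - S| + 1\<close> vertices of \<open>S - S'\<close> improves \<open>S'\<close> by flipping at most \<open>2c + 1\<close> vertices. Local
  search over such flips, which needs recognition of the sparse class only, thus reaches
  \<open>|S'| \<ge> |S|\<close> within \<open>n\<close> rounds. Then \<open>|S - S'| \<le> |S' - S| \<le> c\<close>, so an independent set \<open>J\<close> has
  at most \<open>t - 1 + c\<close> vertices outside \<open>S'\<close>. Trying all sets \<open>X\<close> of at most \<open>t + c\<close> vertices, and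
  extending \<open>X\<close> by a maximum independent set of \<open>S' - N(X)\<close>, finds an independent set as large
  as \<open>J\<close>.

  The constant factor of the running time must not depend on \<open>t\<close>: the algorithm for the least
  admissible \<open>t\<close> serves all others.
\<close>

section \<open>Programs as computable functions on trees\<close>

text \<open>The bulk of the proof concerns running time, and yet no WHILE program for the whole
  algorithm is written down. The predicate \<open>computes\<close> asserts that one program works
  for a family of instances; its rules for pairs, branches and loops let programs be assembled along
  the definitions of the functions that they compute.

  Two restrictions on the given programs shape the algorithm. Both accept vertex sets
  \<open>{..<k}\<close> only, so induced subgraphs are renumbered before a call, and an independent
  set found is translated back. The program for independent sets may diverge outside the sparse
  class, so it is called only on subgraphs of \<open>S'\<close>, which belong to the class by
  heredity. Since every call concerns at most \<open>n\<close> vertices, monotone time bounds let it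
  be charged as a call on \<open>n\<close> vertices.

  The constant factor is delicate because the program text grows with the size of the enumerated
  sets, and because passing from \<open>Suc n\<close> to \<open>n\<close> costs a power of 2 that
  grows likewise. The degree of the polynomial comes from a list of
  \<open>n ^ (2 * c + t + 1)\<close> sets, which every round of the search traverses.\<close>

fun expr_bound :: "expr \<Rightarrow> nat" where
  "expr_bound (Var x) = Suc x"
| "expr_bound NilE = 0"
| "expr_bound (ConsE e f) = max (expr_bound e) (expr_bound f)"
| "expr_bound (HdE e) = expr_bound e"
| "expr_bound (TlE e) = expr_bound e"

text \<open>A strict bound on the occurring variables: those from the bound on are free to hold data
  of a surrounding program.\<close>

fun cmd_bound :: "cmd \<Rightarrow> nat" where
  "cmd_bound (Assign x e) = max (Suc x) (expr_bound e)"
| "cmd_bound (Seq p q) = max (cmd_bound p) (cmd_bound q)"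
| "cmd_bound (If e p q) = max (expr_bound e) (max (cmd_bound p) (cmd_bound q))"
| "cmd_bound (While e p) = max (expr_bound e) (cmd_bound p)"

lemma eval_expr_cong:
  "\<forall>x<expr_bound e. r x = s x \<Longrightarrow> eval_expr e r = eval_expr e s"
  by (induction e) auto

text \<open>By induction on the run, which reads and writes variables below \<open>N\<close> only.
  So a run known from the standard initial store can be replayed, in the same time, while the higher
  variables hold other data.\<close>

lemma exec_frame:
  assumes "exec p s k s'" "cmd_bound p \<le> N" "\<forall>x<N. r x = s x"
  shows "\<exists>r'. exec p r k r' \<and> (\<forall>x<N. r' x = s' x) \<and> (\<forall>x\<ge>N. r' x = r x)"
  using assms
proof (induction arbitrary: r rule: exec.induct)
  case (Assign x e s)
  have "eval_expr e r = eval_expr e s"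
    by (rule eval_expr_cong) (use Assign in auto)
  then show ?case
    using Assign.prems by (intro exI[of _ "r(x := eval_expr e r)"] conjI exec.Assign) auto
next
  case (Seq p s k s' q l s'')
  obtain r' where r': "exec p r k r'" "\<forall>x<N. r' x = s' x" "\<forall>x\<ge>N. r' x = r x"
    using Seq.IH(1)[of r] Seq.prems by auto
  obtain r'' where r'': "exec q r' l r''" "\<forall>x<N. r'' x = s'' x" "\<forall>x\<ge>N. r'' x = r' x"
    using Seq.IH(2)[of r'] Seq.prems r'(2) by auto
  show ?case
    using r' r'' by (intro exI[of _ r''] conjI exec.Seq[OF r'(1) r''(1)]) auto
next
  case (IfTrue e s p k s' q)
  have "eval_expr e r = eval_expr e s"
    by (rule eval_expr_cong) (use IfTrue in auto)
  moreover obtain r' where r': "exec p r k r'" "\<forall>x<N. r' x = s' x" "\<forall>x\<ge>N. r' x = r x"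
    using IfTrue.IH[of r] IfTrue.prems by auto
  ultimately show ?case
    using IfTrue.hyps(1) by (intro exI[of _ r'] conjI exec.IfTrue[OF _ r'(1)]) auto
next
  case (IfFalse e s q k s' p)
  have "eval_expr e r = eval_expr e s"
    by (rule eval_expr_cong) (use IfFalse in auto)
  moreover obtain r' where r': "exec q r k r'" "\<forall>x<N. r' x = s' x" "\<forall>x\<ge>N. r' x = r x"
    using IfFalse.IH[of r] IfFalse.prems by auto
  ultimately show ?case
    using IfFalse.hyps(1) by (intro exI[of _ r'] conjI exec.IfFalse[OF _ r'(1)]) auto
next
  case (WhileTrue e s p k s' l s'')
  have e: "eval_expr e r = eval_expr e s"
    by (rule eval_expr_cong) (use WhileTrue in auto)
  obtain r' where r': "exec p r k r'" "\<forall>x<N. r' x = s' x" "\<forall>x\<ge>N. r' x = r x"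
    using WhileTrue.IH(1)[of r] WhileTrue.prems by auto
  obtain r'' where r'':
    "exec (While e p) r' l r''" "\<forall>x<N. r'' x = s'' x" "\<forall>x\<ge>N. r'' x = r' x"
    using WhileTrue.IH(2)[of r'] WhileTrue.prems r'(2) by auto
  show ?case using e WhileTrue.hyps(1) r' r''
    by (intro exI[of _ r''] conjI exec.WhileTrue[OF _ r'(1) r''(1)]) auto
next
  case (WhileFalse e s p)
  have "eval_expr e r = eval_expr e s"
    by (rule eval_expr_cong) (use WhileFalse in auto)
  with WhileFalse show ?case by (intro exI[of _ r] conjI exec.WhileFalse) auto
qed

lemma exec_pos: "exec p s k s' \<Longrightarrow> k > 0"
  by (induction rule: exec.induct) auto

text \<open>In contrast to \<^const>\<open>runs\<close>, a clean program makes no assumption on the initial values of its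
  auxiliary variables, and it leaves the variables from \<open>N\<close> on untouched; so clean programs can be
  composed and iterated.\<close>

definition clean :: "cmd \<Rightarrow> nat \<Rightarrow> tree \<Rightarrow> tree \<Rightarrow> nat \<Rightarrow> bool" where
  "clean p N x y b \<longleftrightarrow>
     (\<forall>r. r 0 = x \<longrightarrow> (\<exists>r' k. exec p r k r' \<and> k \<le> b \<and> r' 0 = y \<and> (\<forall>z\<ge>N. r' z = r z)))"

lemma cleanI:
  assumes "\<And>r. r 0 = x \<Longrightarrow>
    \<exists>r' k. exec p r k r' \<and> k \<le> b \<and> r' 0 = y \<and> (\<forall>z\<ge>N. r' z = r z)"
  shows "clean p N x y b"
  using assms unfolding clean_def by blast

lemma cleanE:
  assumes "clean p N x y b" "r 0 = x"
  obtains r' k where "exec p r k r'" "k \<le> b" "r' 0 = y" "\<And>z. z \<ge> N \<Longrightarrow> r' z = r z"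
  using assms unfolding clean_def by blast

lemma clean_mono:
  assumes "clean p N x y b" "b \<le> b'"
  shows "clean p N x y b'"
proof (rule cleanI)
  fix r :: store assume "r 0 = x"
  with assms(1) obtain r' k where "exec p r k r'" "k \<le> b" "r' 0 = y" "\<And>z. z \<ge> N \<Longrightarrow> r' z = r z"
    by (rule cleanE) blast
  then show "\<exists>r' k. exec p r k r' \<and> k \<le> b' \<and> r' 0 = y \<and> (\<forall>z\<ge>N. r' z = r z)"
    using assms(2) by (intro exI[of _ r'] exI[of _ k]) auto
qed

lemma clean_pos: "clean p N x y b \<Longrightarrow> b > 0"
  by (erule cleanE[where r = "\<lambda>_. x"]) (auto dest: exec_pos)

lemma clean_runs: "clean p N x y b \<Longrightarrow> \<exists>k\<le>b. runs p x y k"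
  by (erule cleanE[where r = "(\<lambda>_. Nil_tree)(0 := x)"]) (auto simp: runs_def)

text \<open>The language has no command that does nothing; \<open>Assign 0 (Var 0)\<close> stands in
  for it. Variable 0 is spared because it holds the input.\<close>

fun clear :: "nat \<Rightarrow> cmd" where
  "clear 0 = Assign 0 (Var 0)"
| "clear (Suc n) = Seq (clear n) (Assign (Suc n) NilE)"

lemma exec_clear:
  "exec (clear n) r (2 * n + 2) (\<lambda>x. if 0 < x \<and> x \<le> n then Nil_tree else r x)"
proof (induction n)
  case 0
  have "r(0 := eval_expr (Var 0) r) = (\<lambda>x. if 0 < x \<and> x \<le> 0 then Nil_tree else r x)"
    by auto
  then show ?case using exec.Assign[of 0 "Var 0" r] by (simp add: numeral_2_eq_2)
next
  case (Suc n)
  let ?s = "\<lambda>x. if 0 < x \<and> x \<le> n then Nil_tree else r x"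
  have "?s(Suc n := Nil_tree) = (\<lambda>x. if 0 < x \<and> x \<le> Suc n then Nil_tree else r x)"
    by auto
  then show ?case using exec.Seq[OF Suc exec.Assign[of "Suc n" NilE ?s]] by simp
qed

text \<open>To a program whose variables are below the bound, a store with the auxiliary variables
  reset looks like the initial store of \<open>runs\<close>, so \<open>exec_frame\<close>
  applies.\<close>

lemma runs_clean:
  assumes "cmd_bound p \<le> N" "runs p x y k"
  shows "clean (Seq (clear N) p) (Suc N) x y (2 * N + 2 + k)"
proof (rule cleanI)
  fix r :: store
  assume r: "r 0 = x"
  let ?s = "\<lambda>z. if 0 < z \<and> z \<le> N then Nil_tree else r z"
  obtain s where s: "exec p ((\<lambda>_. Nil_tree)(0 := x)) k s" "s 0 = y"
    using assms by (auto simp: runs_def)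
  obtain r' where r': "exec p ?s k r'" "\<forall>z<Suc N. r' z = s z" "\<forall>z\<ge>Suc N. r' z = ?s z"
  proof -
    \<comment> \<open>The frame is \<open>Suc N\<close>, not \<open>N\<close>, since
      \<open>clear N\<close> also resets variable \<open>N\<close>.\<close>
    have "\<forall>z<Suc N. ?s z = ((\<lambda>_. Nil_tree)(0 := x)) z" using r by auto
    from exec_frame[OF s(1) le_SucI[OF assms(1)] this] show ?thesis using that by blast
  qed
  show "\<exists>r' k'. exec (Seq (clear N) p) r k' r' \<and> k' \<le> 2 * N + 2 + k \<and> r' 0 = y \<and>
    (\<forall>z\<ge>Suc N. r' z = r z)"
  proof (intro exI conjI)
    show "exec (Seq (clear N) p) r (2 * N + 2 + k) r'" by (rule exec.Seq[OF exec_clear r'(1)])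
  qed (use r'(2,3) s(2) in auto)
qed

text \<open>The index \<open>i\<close> ranges over problem instances: one program maps the encoding \<open>f i\<close> to \<open>g i\<close> in time
  \<open>O(T i)\<close>, uniformly in \<open>i \<in> A\<close>. In the rules below \<open>f\<close> acts as an environment from which all
  intermediate results are computed.\<close>

definition computes :: "'i set \<Rightarrow> ('i \<Rightarrow> tree) \<Rightarrow> ('i \<Rightarrow> tree) \<Rightarrow> ('i \<Rightarrow> nat) \<Rightarrow> bool" where
  "computes A f g T \<longleftrightarrow> (\<exists>p N K. \<forall>i\<in>A. clean p N (f i) (g i) (K * T i))"

lemma computesI:
  assumes "\<And>i. i \<in> A \<Longrightarrow> clean p N (f i) (g i) (K * T i)"
  shows "computes A f g T"
  using assms unfolding computes_def by blast

lemma computesE: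
  assumes "computes A f g T"
  obtains p N K where "\<And>i. i \<in> A \<Longrightarrow> clean p N (f i) (g i) (K * T i)"
  using assms unfolding computes_def by blast

text \<open>The entrance for the two given programs, as \<open>computes_runs\<close> is the exit.
  Clearing the variables costs a number that depends on the program only; as \<open>T i\<close> is
  at least 1, the factor absorbs it.\<close>

lemma runs_computes:
  assumes "\<And>i. i \<in> A \<Longrightarrow> \<exists>k\<le>T i. runs p (f i) (g i) k"
  shows "computes A f g T"
proof (rule computesI)
  fix i assume i: "i \<in> A"
  let ?N = "cmd_bound p"
  obtain k where k: "runs p (f i) (g i) k" "k \<le> T i" using assms[OF i] by blast
  then have "k > 0" unfolding runs_def by (auto dest: exec_pos)
  with k(2) have "T i \<ge> 1" by simp
  then have "2 * ?N + 2 \<le> (2 * ?N + 2) * T i"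
    using mult_le_mono2[of 1 "T i" "2 * ?N + 2"] by simp
  then show "clean (Seq (clear ?N) p) (Suc ?N) (f i) (g i) ((2 * ?N + 3) * T i)"
    using clean_mono[OF runs_clean[OF order_refl k(1)], of "(2 * ?N + 3) * T i"] k(2)
    by (simp add: add_mult_distrib)
qed

lemma computes_runs:
  assumes "computes A f g T"
  shows "\<exists>p K. \<forall>i\<in>A. \<exists>k\<le>K * T i. runs p (f i) (g i) k"
  using assms unfolding computes_def by (meson clean_runs)

text \<open>Every run takes at least one time unit. Hence the constant overhead of glue code can
  always be charged to the factor in front of \<open>T i\<close>.\<close>

lemma computes_time_pos: "computes A f g T \<Longrightarrow> i \<in> A \<Longrightarrow> T i > 0"
  by (metis clean_pos computesE gr0I mult_0_right less_numeral_extra(3))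

lemma computes_cong:
  "computes A f g T \<Longrightarrow> (\<And>i. i \<in> A \<Longrightarrow> g i = g' i) \<Longrightarrow> computes A f g' T"
  unfolding computes_def by metis

lemma computes_mono:
  assumes "computes A f g T" "\<And>i. i \<in> A \<Longrightarrow> T i \<le> C * U i"
  shows "computes A f g U"
proof -
  obtain p N K where p: "\<And>i. i \<in> A \<Longrightarrow> clean p N (f i) (g i) (K * T i)"
    using assms(1) unfolding computes_def by blast
  have "K * T i \<le> (K * C) * U i" if "i \<in> A" for i
    using mult_le_mono2[OF assms(2)[OF that], of K] by (simp add: mult.assoc)
  with p show ?thesis by (meson clean_mono computesI)
qed

text \<open>Instances are renamed in this way when a rule is used under a loop, where an index also
  carries the loop state.\<close>

lemma computes_reindex:
  assumes "computes A f g T" "\<And>i. i \<in> B \<Longrightarrow> \<phi> i \<in> A"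
  shows "computes B (\<lambda>i. f (\<phi> i)) (\<lambda>i. g (\<phi> i)) (\<lambda>i. T (\<phi> i))"
  using assms unfolding computes_def by meson

lemma computes_subset: "computes A f g T \<Longrightarrow> B \<subseteq> A \<Longrightarrow> computes B f g T"
  unfolding computes_def by (meson subsetD)

section \<open>Composition of programs\<close>

lemma exec_Assign_eq:
  "s' = s(x := eval_expr e s) \<Longrightarrow> k = 1 + expr_time e \<Longrightarrow> exec (Assign x e) s k s'"
  using exec.Assign[of x e s] by simp

lemma computes_expr:
  assumes "\<And>i. i \<in> A \<Longrightarrow> T i > 0"
    "\<And>i s. i \<in> A \<Longrightarrow> s 0 = f i \<Longrightarrow> eval_expr e s = g i"
  shows "computes A f g T"
proof (rule computesI)
  fix i assume i: "i \<in> A"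
  have "1 + expr_time e \<le> (1 + expr_time e) * T i"
    using mult_le_mono2[of 1 "T i" "1 + expr_time e"] assms(1)[OF i] by simp
  then show "clean (Assign 0 e) 1 (f i) (g i) ((1 + expr_time e) * T i)"
    using exec.Assign[of 0 e] assms(2)[OF i] by (intro cleanI) fastforce
qed

lemma computes_trans:
  assumes "computes A f g T" "computes A g h T"
  shows "computes A f h T"
proof -
  obtain p N K where p: "\<And>i. i \<in> A \<Longrightarrow> clean p N (f i) (g i) (K * T i)"
    using assms(1) unfolding computes_def by blast
  obtain q M L where q: "\<And>i. i \<in> A \<Longrightarrow> clean q M (g i) (h i) (L * T i)"
    using assms(2) unfolding computes_def by blast
  show ?thesis
  proof (intro computesI cleanI)
    fix i and r :: store assume i: "i \<in> A" and r: "r 0 = f i"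
    obtain r' k where r': "exec p r k r'" "k \<le> K * T i" "r' 0 = g i"
      "\<And>z. z \<ge> N \<Longrightarrow> r' z = r z" using p[OF i] r by (rule cleanE) blast
    obtain r'' l where r'': "exec q r' l r''" "l \<le> L * T i" "r'' 0 = h i"
      "\<And>z. z \<ge> M \<Longrightarrow> r'' z = r' z" using q[OF i] r'(3) by (rule cleanE) blast
    show "\<exists>r' k. exec (Seq p q) r k r' \<and> k \<le> (K + L) * T i \<and> r' 0 = h i \<and>
        (\<forall>z\<ge>max N M. r' z = r z)"
      using exec.Seq[OF r'(1) r''(1)] r' r''
      by (intro exI[of _ r''] exI[of _ "k + l"]) (auto simp: add_mult_distrib)
  qed
qed

lemma computes_pair:
  assumes "computes A f g T" "computes A f h T"
  shows "computes A f (\<lambda>i. Dot (g i) (h i)) T"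
proof -
  obtain p N K where p: "\<And>i. i \<in> A \<Longrightarrow> clean p N (f i) (g i) (K * T i)"
    using assms(1) unfolding computes_def by blast
  obtain q M L where q: "\<And>i. i \<in> A \<Longrightarrow> clean q M (f i) (h i) (L * T i)"
    using assms(2) unfolding computes_def by blast
  \<comment> \<open>\<open>B\<close> and \<open>Suc B\<close> lie beyond the reach of both programs
    and differ from 0; they keep the input for \<open>q\<close> and the result of
    \<open>p\<close>.\<close>
  define B where "B = Suc (max N M)"
  have B: "B \<ge> N" "B \<ge> M" "B > 0" by (auto simp: B_def)
  let ?c = "Seq (Assign B (Var 0)) (Seq p (Seq (Assign (Suc B) (Var 0))
    (Seq (Assign 0 (Var B)) (Seq q (Assign 0 (ConsE (Var (Suc B)) (Var 0)))))))"
  show ?thesis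
  proof (intro computesI cleanI)
    fix i and r :: store assume i: "i \<in> A" and r: "r 0 = f i"
    let ?r = "r(B := f i)"
    obtain r' k where r': "exec p ?r k r'" "k \<le> K * T i" "r' 0 = g i"
      "\<And>z. z \<ge> N \<Longrightarrow> r' z = ?r z" by (rule cleanE[OF p[OF i], of ?r]) (use r B in auto)
    let ?r' = "r'(Suc B := g i, 0 := f i)"
    obtain r'' l where r'': "exec q ?r' l r''" "l \<le> L * T i" "r'' 0 = h i"
      "\<And>z. z \<ge> M \<Longrightarrow> r'' z = ?r' z" by (rule cleanE[OF q[OF i], of ?r']) auto
    have "exec ?c r (2 + (k + (2 + (2 + (l + 4))))) (r''(0 := Dot (g i) (h i)))"
      apply (rule exec.Seq, rule exec_Assign_eq, rule refl, simp)
      apply (rule exec.Seq, simp add: r, rule r'(1))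
      apply (rule exec.Seq, rule exec_Assign_eq, rule refl, simp)
      apply (rule exec.Seq, rule exec_Assign_eq, rule refl, simp)
      apply (rule exec.Seq)
      using r''(1) r' B apply simp
      apply (rule exec_Assign_eq)
      using r'' B by auto
    moreover have "\<forall>z\<ge>Suc (Suc B). (r''(0 := Dot (g i) (h i))) z = r z"
      using r'' r' B by auto
    moreover have "2 + (k + (2 + (2 + (l + 4)))) \<le> (K + L + 10) * T i"
      using r'(2) r''(2) computes_time_pos[OF assms(1) i]
      by (simp add: add_mult_distrib)
    ultimately show "\<exists>r' k. exec ?c r k r' \<and> k \<le> (K + L + 10) * T i \<and>
        r' 0 = Dot (g i) (h i) \<and> (\<forall>z\<ge>Suc (Suc B). r' z = r z)"
      by (metis fun_upd_same)
  qed
qed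

lemma computes_if:
  assumes "computes A f c T" "computes {i \<in> A. c i \<noteq> Nil_tree} f g T"
    "computes {i \<in> A. c i = Nil_tree} f h T"
  shows "computes A f (\<lambda>i. if c i \<noteq> Nil_tree then g i else h i) T"
proof -
  let ?P = "{i \<in> A. c i \<noteq> Nil_tree}" and ?Q = "{i \<in> A. c i = Nil_tree}"
  obtain p N K where p: "\<And>i. i \<in> A \<Longrightarrow> clean p N (f i) (c i) (K * T i)"
    using assms(1) unfolding computes_def by blast
  obtain q N1 K1 where q: "\<And>i. i \<in> ?P \<Longrightarrow> clean q N1 (f i) (g i) (K1 * T i)"
    using assms(2) unfolding computes_def by blast
  obtain q' N2 K2 where q': "\<And>i. i \<in> ?Q \<Longrightarrow> clean q' N2 (f i) (h i) (K2 * T i)"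
    using assms(3) unfolding computes_def by blast
  \<comment> \<open>\<open>B\<close> keeps the input, which computing the condition overwrites, and
    \<open>Suc B\<close> keeps the condition.\<close>
  define B where "B = Suc (max N (max N1 N2))"
  have B: "B \<ge> N" "B \<ge> N1" "B \<ge> N2" "B > 0" by (auto simp: B_def)
  let ?c = "Seq (Assign B (Var 0)) (Seq p (Seq (Assign (Suc B) (Var 0))
    (Seq (Assign 0 (Var B)) (If (Var (Suc B)) q q'))))"
  let ?y = "\<lambda>i. if c i \<noteq> Nil_tree then g i else h i"
  show ?thesis
  proof (intro computesI cleanI)
    fix i and r :: store assume i: "i \<in> A" and r: "r 0 = f i"
    let ?r = "r(B := f i)"
    obtain r' k where r': "exec p ?r k r'" "k \<le> K * T i" "r' 0 = c i"
      "\<And>z. z \<ge> N \<Longrightarrow> r' z = ?r z" by (rule cleanE[OF p[OF i], of ?r]) (use r B in auto)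
    let ?r' = "r'(Suc B := c i, 0 := f i)"
    have "\<exists>r'' l. exec (If (Var (Suc B)) q q') ?r' l r'' \<and> l \<le> (K1 + K2) * T i + 2 \<and>
      r'' 0 = ?y i \<and> (\<forall>z\<ge>B. r'' z = ?r' z)"
    proof (cases "c i = Nil_tree")
      case True
      with i have "i \<in> ?Q" by simp
      then obtain r'' l where r'': "exec q' ?r' l r''" "l \<le> K2 * T i" "r'' 0 = h i"
        "\<And>z. z \<ge> N2 \<Longrightarrow> r'' z = ?r' z" by (rule cleanE[OF q', of i ?r']) auto
      have "exec (If (Var (Suc B)) q q') ?r' (1 + expr_time (Var (Suc B)) + l) r''"
        by (rule exec.IfFalse) (use True r'' in auto)
      then show ?thesis using r'' True B
        by (intro exI[of _ r''] exI[of _ "l + 2"]) (auto simp: add_mult_distrib)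
    next
      case False
      with i have "i \<in> ?P" by simp
      then obtain r'' l where r'': "exec q ?r' l r''" "l \<le> K1 * T i" "r'' 0 = g i"
        "\<And>z. z \<ge> N1 \<Longrightarrow> r'' z = ?r' z" by (rule cleanE[OF q, of i ?r']) auto
      have "exec (If (Var (Suc B)) q q') ?r' (1 + expr_time (Var (Suc B)) + l) r''"
        by (rule exec.IfTrue) (use False r'' in auto)
      then show ?thesis using r'' False B
        by (intro exI[of _ r''] exI[of _ "l + 2"]) (auto simp: add_mult_distrib)
    qed
    then obtain r'' l where r'': "exec (If (Var (Suc B)) q q') ?r' l r''"
      "l \<le> (K1 + K2) * T i + 2" "r'' 0 = ?y i" "\<And>z. z \<ge> B \<Longrightarrow> r'' z = ?r' z" by blast
    have "exec ?c r (2 + (k + (2 + (2 + l)))) r''"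
      apply (rule exec.Seq, rule exec_Assign_eq, rule refl, simp)
      apply (rule exec.Seq, simp add: r, rule r'(1))
      apply (rule exec.Seq, rule exec_Assign_eq, rule refl, simp)
      apply (rule exec.Seq, rule exec_Assign_eq, rule refl, simp)
      using r''(1) r' B by simp
    moreover have "\<forall>z\<ge>Suc (Suc B). r'' z = r z"
      using r'' r' B by auto
    moreover have "2 + (k + (2 + (2 + l))) \<le> (K + K1 + K2 + 8) * T i"
      using r'(2) r''(2) computes_time_pos[OF assms(1) i]
      by (simp add: add_mult_distrib)
    ultimately show "\<exists>r' k. exec ?c r k r' \<and> k \<le> (K + K1 + K2 + 8) * T i \<and>
        r' 0 = ?y i \<and> (\<forall>z\<ge>Suc (Suc B). r' z = r z)"
      using r''(3) by blast
  qed
qed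

text \<open>The loop rule. The body sees the state, the current list element and the whole input, so
  loops can be nested without losing access to earlier data. The round number \<open>j\<close>
  indexes the instances, but the program learns of it only what state and element reveal.\<close>

lemma computes_fold:
  assumes init: "computes A f (\<lambda>i. st i 0) T"
    and list: "computes A f (\<lambda>i. enc_list (map (el i) [0..<len i])) T"
    and body: "computes {(i, j). i \<in> A \<and> j < len i}
      (\<lambda>p. Dot (st (fst p) (snd p)) (Dot (el (fst p) (snd p)) (f (fst p))))
      (\<lambda>p. st (fst p) (Suc (snd p))) (\<lambda>p. U (fst p))"
    and time: "\<And>i. i \<in> A \<Longrightarrow> len i * U i \<le> C * T i"
  shows "computes A f (\<lambda>i. st i (len i)) T"
proof -
  let ?D = "{(i, j). i \<in> A \<and> j < len i}"
  obtain q N K where q: "\<And>p. p \<in> ?D \<Longrightarrow> clean q N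
      (Dot (st (fst p) (snd p)) (Dot (el (fst p) (snd p)) (f (fst p))))
      (st (fst p) (Suc (snd p))) (K * U (fst p))"
    using body unfolding computes_def by blast
  define B where "B = Suc N"
  have B: "B \<ge> N" "B > 0" by (auto simp: B_def)
  let ?l = "\<lambda>i j. enc_list (map (el i) [j..<len i])"
  let ?b = "Seq (Assign 0 (ConsE (Var 0) (ConsE (HdE (Var (Suc B))) (Var B))))
    (Seq q (Assign (Suc B) (TlE (Var (Suc B)))))"
  let ?w = "While (Var (Suc B)) ?b"
  let ?c = "Seq (Assign B (TlE (TlE (Var 0)))) (Seq (Assign (Suc B) (HdE (TlE (Var 0))))
    (Seq (Assign 0 (HdE (Var 0))) ?w))"
  \<comment> \<open>With \<open>j\<close> elements consumed, variable 0 holds the state,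
    \<open>B\<close> the input and \<open>Suc B\<close> the remaining list. Besides the body, a
    round costs 12: 2 for the test, 7 for packing the arguments, 3 for removing the element. The
    last test costs 2.\<close>
  have loop: "\<exists>k' r'. exec ?w r k' r' \<and> k' \<le> 2 + (len i - j) * (K * U i + 12) \<and>
      r' 0 = st i (len i) \<and> (\<forall>z>Suc B. r' z = r z)"
    if "i \<in> A" "j \<le> len i" "r 0 = st i j" "r B = f i" "r (Suc B) = ?l i j" for i j r
    using that(2-)
  proof (induction "len i - j" arbitrary: j r)
    case 0
    then have "exec ?w r (1 + expr_time (Var (Suc B))) r"
      by (intro exec.WhileFalse) auto
    with 0 show ?case by (intro exI[of _ "Suc (Suc 0)"] exI[of _ r]) auto
  next
    case (Suc m)
    then have j: "j < len i" by simp
    with that(1) have ij: "(i, j) \<in> ?D" by simp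
    have l: "?l i j = Dot (el i j) (?l i (Suc j))"
      using j by (simp add: upt_conv_Cons)
    let ?r = "r(0 := Dot (st i j) (Dot (el i j) (f i)))"
    obtain r' k where r': "exec q ?r k r'" "k \<le> K * U i" "r' 0 = st i (Suc j)"
      "\<And>z. z \<ge> N \<Longrightarrow> r' z = ?r z" by (rule cleanE[OF q[OF ij], of ?r]) auto
    let ?r' = "r'(Suc B := ?l i (Suc j))"
    have b: "exec ?b r (7 + (k + 3)) ?r'"
      apply (rule exec.Seq, rule exec_Assign_eq, rule refl, simp)
      apply (rule exec.Seq)
      using Suc.prems l r' apply simp
      apply (rule exec_Assign_eq)
      using Suc.prems l r' B by auto
    have "m = len i - Suc j" "Suc j \<le> len i" "?r' 0 = st i (Suc j)" "?r' B = f i"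
      "?r' (Suc B) = ?l i (Suc j)"
      using Suc r' B j by auto
    from Suc.hyps(1)[OF this] obtain k' r'' where
      w: "exec ?w ?r' k' r''" "k' \<le> 2 + (len i - Suc j) * (K * U i + 12)"
      "r'' 0 = st i (len i)" "\<forall>z>Suc B. r'' z = ?r' z"
      by blast
    have "exec ?w r (1 + expr_time (Var (Suc B)) + (7 + (k + 3)) + k') r''"
      by (rule exec.WhileTrue[OF _ b w(1)]) (use Suc.prems l in simp)
    moreover have "1 + expr_time (Var (Suc B)) + (7 + (k + 3)) + k'
        \<le> 2 + (len i - j) * (K * U i + 12)"
      using w(2) r'(2) Suc.hyps(2) j by (simp add: Suc_diff_Suc[symmetric])
    ultimately show ?case using w(3,4) r' B
      by (intro exI[of _ "1 + expr_time (Var (Suc B)) + (7 + (k + 3)) + k'"] exI[of _ r'']) auto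
  qed
  \<comment> \<open>The overhead of 12 per round must fit into the bound as well. A nonempty list
    forces \<open>U i > 0\<close>, because the body takes time, so the length is at most
    \<open>len i * U i\<close>.\<close>
  have len_le: "len i \<le> C * T i" if "i \<in> A" for i
  proof (cases "len i = 0")
    case False
    then have "U i > 0" using computes_time_pos[OF body, of "(i, 0)"] that by simp
    then have "len i * 1 \<le> len i * U i" by (intro mult_le_mono2) simp
    then show ?thesis using time[OF that] by linarith
  qed simp
  have "computes A (\<lambda>i. Dot (st i 0) (Dot (?l i 0) (f i))) (\<lambda>i. st i (len i)) T"
  proof (intro computesI cleanI)
    fix i and r :: store
    assume i: "i \<in> A" and r: "r 0 = Dot (st i 0) (Dot (?l i 0) (f i))"
    let ?r = "r(B := f i, Suc B := ?l i 0, 0 := st i 0)"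
    obtain k' r' where w: "exec ?w ?r k' r'" "k' \<le> 2 + (len i - 0) * (K * U i + 12)"
      "r' 0 = st i (len i)" "\<And>z. z > Suc B \<Longrightarrow> r' z = ?r z"
      using loop[OF i, of 0 ?r] B by auto
    have "exec ?c r (4 + (4 + (3 + k'))) r'"
      apply (rule exec.Seq, rule exec_Assign_eq, rule refl, simp)
      apply (rule exec.Seq, rule exec_Assign_eq, rule refl, simp)
      apply (rule exec.Seq, rule exec_Assign_eq, rule refl, simp)
      using w(1) r B by (simp add: fun_upd_twist)
    moreover have "4 + (4 + (3 + k')) \<le> (13 + K * C + 12 * C) * T i"
    proof -
      have "len i * (K * U i + 12) = K * (len i * U i) + 12 * len i"
        by (simp add: algebra_simps)
      also have "\<dots> \<le> K * (C * T i) + 12 * (C * T i)"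
        by (intro add_mono mult_le_mono2 time len_le i)
      finally show ?thesis
        using w(2) computes_time_pos[OF init i] by (simp add: algebra_simps)
    qed
    ultimately show "\<exists>r' k. exec ?c r k r' \<and> k \<le> (13 + K * C + 12 * C) * T i \<and>
        r' 0 = st i (len i) \<and> (\<forall>z\<ge>Suc (Suc B). r' z = r z)"
      using w(3,4) by (intro exI[of _ r'] exI[of _ "4 + (4 + (3 + k'))"]) auto
  qed
  moreover have "computes A f f T"
    by (rule computes_expr[where e = "Var 0"]) (use computes_time_pos[OF init] in auto)
  ultimately show ?thesis
    using init list by (blast intro: computes_trans computes_pair)
qed

section \<open>Environments and basic rules\<close>

lemma computes_const:
  assumes "\<And>i. i \<in> A \<Longrightarrow> T i > 0"
  shows "computes A f (\<lambda>_. t) T"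
proof (induction t)
  case Nil_tree
  show ?case by (rule computes_expr[where e = NilE]) (use assms in auto)
next
  case (Dot t u)
  then show ?case by (rule computes_pair)
qed

lemma computes_id:
  assumes "\<And>i. i \<in> A \<Longrightarrow> T i > 0"
  shows "computes A f f T"
  by (rule computes_expr[where e = "Var 0"]) (use assms in auto)

lemma computes_hd:
  assumes "computes A f g T"
  shows "computes A f (\<lambda>i. hd_tree (g i)) T"
  by (rule computes_trans[OF assms], rule computes_expr[where e = "HdE (Var 0)"])
    (auto dest: computes_time_pos[OF assms])

lemma computes_tl:
  assumes "computes A f g T"
  shows "computes A f (\<lambda>i. tl_tree (g i)) T"
  by (rule computes_trans[OF assms], rule computes_expr[where e = "TlE (Var 0)"])
    (auto dest: computes_time_pos[OF assms])

lemma computes_fst: "computes A f (\<lambda>i. Dot (g i) (h i)) T \<Longrightarrow> computes A f g T"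
  by (drule computes_hd) simp

lemma computes_snd: "computes A f (\<lambda>i. Dot (g i) (h i)) T \<Longrightarrow> computes A f h T"
  by (drule computes_tl) simp

lemma computes_head:
  assumes "\<And>i. i \<in> A \<Longrightarrow> T i > 0"
  shows "computes A (\<lambda>i. Dot (g i) (h i)) g T"
  by (rule computes_fst, rule computes_id) (rule assms)

lemma computes_weaken:
  assumes "computes A h g T"
  shows "computes A (\<lambda>i. Dot (g' i) (h i)) g T"
  by (rule computes_trans[OF _ assms], rule computes_snd, rule computes_id)
    (rule computes_time_pos[OF assms])

text \<open>The input of \<open>computes\<close> serves as an environment: an intermediate result is
  put in front of it, to be read by \<open>computes_head\<close>, while
  \<open>computes_weaken\<close> skips it to reach older values.\<close>

lemma computes_let:
  assumes "computes A f g T" "computes A (\<lambda>i. Dot (g i) (f i)) h T"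
  shows "computes A f h T"
  by (rule computes_trans[OF computes_pair[OF assms(1)] assms(2)], rule computes_id)
    (rule computes_time_pos[OF assms(1)])

lemma enc_bool_eq_Nil [simp]: "enc_bool b = Nil_tree \<longleftrightarrow> \<not> b"
  by (simp add: enc_bool_def)

lemma computes_if_bool:
  assumes "computes A f (\<lambda>i. enc_bool (b i)) T" "computes {i \<in> A. b i} f g T"
    "computes {i \<in> A. \<not> b i} f h T"
  shows "computes A f (\<lambda>i. if b i then g i else h i) T"
  using computes_if[OF assms(1), of g h] assms(2,3) by simp

text \<open>A boolean operation is a table of four constants, so two nested tests select the
  value.\<close>

lemma computes_bool_op:
  fixes op :: "bool \<Rightarrow> bool \<Rightarrow> bool"
  assumes "computes A f (\<lambda>i. enc_bool (b i)) T" "computes A f (\<lambda>i. enc_bool (c i)) T"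
  shows "computes A f (\<lambda>i. enc_bool (op (b i) (c i))) T"
proof -
  have *: "computes B f (\<lambda>i. if c i then enc_bool x else enc_bool y) T" if "B \<subseteq> A" for B x y
    by (rule computes_if_bool[OF computes_subset[OF assms(2) that]])
      (use that computes_time_pos[OF assms(1)] in \<open>auto intro!: computes_const\<close>)
  have "computes A f (\<lambda>i. if b i then if c i then enc_bool (op True True) else enc_bool (op True False)
      else if c i then enc_bool (op False True) else enc_bool (op False False)) T"
    by (intro computes_if_bool[OF assms(1)] *) auto
  then show ?thesis by (rule computes_cong) auto
qed

text \<open>Compared with \<open>computes_fold\<close>, the body is indexed by the state itself. The
  invariant \<open>P\<close> restricts the states on which it must be correct, for example to vertex
  sets below \<open>n\<close>, whose encodings are faithful.\<close>

lemma computes_foldl: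
  fixes st :: "'i \<Rightarrow> 's \<Rightarrow> tree" and el :: "'i \<Rightarrow> 'e \<Rightarrow> tree"
  assumes init: "computes A f (\<lambda>i. st i (a i)) T"
    and list: "computes A f (\<lambda>i. enc_list (map (el i) (xs i))) T"
    and body: "computes {(i, s, x). i \<in> A \<and> P i s \<and> x \<in> set (xs i)}
      (\<lambda>p. Dot (st (fst p) (fst (snd p))) (Dot (el (fst p) (snd (snd p))) (f (fst p))))
      (\<lambda>p. st (fst p) (h (fst p) (fst (snd p)) (snd (snd p)))) (\<lambda>p. U (fst p))"
    and inv: "\<And>i. i \<in> A \<Longrightarrow> P i (a i)"
      "\<And>i s x. i \<in> A \<Longrightarrow> P i s \<Longrightarrow> x \<in> set (xs i) \<Longrightarrow> P i (h i s x)"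
    and time: "\<And>i. i \<in> A \<Longrightarrow> length (xs i) * U i \<le> C * T i"
  shows "computes A f (\<lambda>i. st i (foldl (h i) (a i) (xs i))) T"
proof -
  define g where "g i j = foldl (h i) (a i) (take j (xs i))" for i j
  have P: "P i (g i j)" if "i \<in> A" "j \<le> length (xs i)" for i j
    using that(2)
  proof (induction j)
    case (Suc j)
    then show ?case using inv(2)[OF that(1)] by (simp add: g_def take_Suc_conv_app_nth)
  qed (simp add: g_def inv(1) that(1))
  have "computes A f (\<lambda>i. st i (g i (length (xs i)))) T"
  proof (rule computes_fold[where el = "\<lambda>i j. el i (xs i ! j)" and st = "\<lambda>i j. st i (g i j)"
        and U = U and C = C])
    show "computes A f (\<lambda>i. enc_list (map (\<lambda>j. el i (xs i ! j)) [0..<length (xs i)])) T"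
      by (rule computes_cong[OF list]) (metis (no_types, lifting) map_nth map_map comp_apply map_cong)
    have "computes {(i, j). i \<in> A \<and> j < length (xs i)}
      (\<lambda>p. Dot (st (fst p) (g (fst p) (snd p))) (Dot (el (fst p) (xs (fst p) ! snd p)) (f (fst p))))
      (\<lambda>p. st (fst p) (h (fst p) (g (fst p) (snd p)) (xs (fst p) ! snd p))) (\<lambda>p. U (fst p))"
      using computes_reindex[OF body, of "{(i, j). i \<in> A \<and> j < length (xs i)}"
          "\<lambda>p. (fst p, g (fst p) (snd p), xs (fst p) ! snd p)"] P by auto
    then show "computes {(i, j). i \<in> A \<and> j < length (xs i)}
      (\<lambda>p. Dot (st (fst p) (g (fst p) (snd p))) (Dot (el (fst p) (xs (fst p) ! snd p)) (f (fst p))))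
      (\<lambda>p. st (fst p) (g (fst p) (Suc (snd p)))) (\<lambda>p. U (fst p))"
      by (rule computes_cong) (auto simp: g_def take_Suc_conv_app_nth)
  qed (use init time in \<open>auto simp: g_def\<close>)
  then show ?thesis by (simp add: g_def)
qed

section \<open>List operations\<close>

lemma computes_rev:
  assumes "computes A f (\<lambda>i. enc_list (xs i)) T" "\<And>i. i \<in> A \<Longrightarrow> length (xs i) \<le> C * T i"
  shows "computes A f (\<lambda>i. enc_list (rev (xs i))) T"
proof -
  have "computes A f (\<lambda>i. enc_list (foldl (\<lambda>ys x. x # ys) [] (xs i))) T"
  proof (rule computes_foldl[where el = "\<lambda>_ x. x" and st = "\<lambda>_. enc_list"
        and P = "\<lambda>_ _. True" and U = "\<lambda>_. 1" and C = C])
    show "computes A f (\<lambda>i. enc_list []) T"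
      by (rule computes_const) (rule computes_time_pos[OF assms(1)])
    show "computes {(i, s, x). i \<in> A \<and> True \<and> x \<in> set (xs i)}
        (\<lambda>p. Dot (enc_list (fst (snd p))) (Dot (snd (snd p)) (f (fst p))))
        (\<lambda>p. enc_list (snd (snd p) # fst (snd p))) (\<lambda>p. 1)"
      by (rule computes_expr[where e = "ConsE (HdE (TlE (Var 0))) (HdE (Var 0))"]) auto
  qed (use assms in auto)
  moreover have "foldl (\<lambda>ys x. x # ys) zs l = rev l @ zs" for l zs :: "tree list"
    by (induction l arbitrary: zs) auto
  ultimately show ?thesis by simp
qed

text \<open>Lists can only be consumed from the front, so the list is reversed and then folded from
  the left.\<close>

lemma computes_foldr:
  fixes st :: "'i \<Rightarrow> 's \<Rightarrow> tree" and el :: "'i \<Rightarrow> 'e \<Rightarrow> tree"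
  assumes init: "computes A f (\<lambda>i. st i (a i)) T"
    and list: "computes A f (\<lambda>i. enc_list (map (el i) (xs i))) T"
    and body: "computes {(i, s, x). i \<in> A \<and> x \<in> set (xs i)}
      (\<lambda>p. Dot (st (fst p) (fst (snd p))) (Dot (el (fst p) (snd (snd p))) (f (fst p))))
      (\<lambda>p. st (fst p) (h (fst p) (snd (snd p)) (fst (snd p)))) (\<lambda>p. U (fst p))"
    and time: "\<And>i. i \<in> A \<Longrightarrow> length (xs i) * U i \<le> C * T i"
  shows "computes A f (\<lambda>i. st i (foldr (h i) (xs i) (a i))) T"
proof -
  have U: "0 < U i" if "i \<in> A" "xs i \<noteq> []" for i
    using computes_time_pos[OF body, of "(i, undefined, hd (xs i))"] that by auto
  have len: "length (xs i) \<le> C * T i" if "i \<in> A" for i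
  proof (cases "xs i = []")
    case False
    then have "length (xs i) * 1 \<le> length (xs i) * U i"
      using U[OF that] by (intro mult_le_mono2) simp
    then show ?thesis using time[OF that] by linarith
  qed simp
  have rev: "computes A f (\<lambda>i. enc_list (map (el i) (rev (xs i)))) T"
    using computes_rev[OF list, of C] len by (simp add: rev_map)
  show ?thesis unfolding foldr_conv_foldl
    by (rule computes_foldl[where P = "\<lambda>_ _. True" and xs = "\<lambda>i. rev (xs i)" and st = st
          and el = el and U = U and C = C]) (use init rev body time in auto)
qed

lemma computes_map:
  fixes el :: "'i \<Rightarrow> 'e \<Rightarrow> tree"
  assumes list: "computes A f (\<lambda>i. enc_list (map (el i) (xs i))) T"
    and body: "computes {(i, x). i \<in> A \<and> x \<in> set (xs i)}
      (\<lambda>p. Dot (el (fst p) (snd p)) (f (fst p))) (\<lambda>p. h (fst p) (snd p)) (\<lambda>p. U (fst p))"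
    and time: "\<And>i. i \<in> A \<Longrightarrow> length (xs i) * U i \<le> C * T i"
  shows "computes A f (\<lambda>i. enc_list (map (h i) (xs i))) T"
proof -
  have "computes A f (\<lambda>i. enc_list (foldr (\<lambda>x ys. h i x # ys) (xs i) [])) T"
  proof (rule computes_foldr[OF _ list _ time, where st = "\<lambda>_. enc_list"])
    show "computes A f (\<lambda>i. enc_list []) T"
      by (rule computes_const) (rule computes_time_pos[OF list])
    let ?B = "{(i, s, x). i \<in> A \<and> x \<in> set (xs i)}"
    have pos: "0 < U (fst p)" if "p \<in> ?B" for p
      using computes_time_pos[OF body, of "(fst p, snd (snd p))"] that by auto
    have "computes ?B (\<lambda>p. Dot (el (fst p) (snd (snd p))) (f (fst p)))
        (\<lambda>p. h (fst p) (snd (snd p))) (\<lambda>p. U (fst p))"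
      using computes_reindex[OF body, of ?B "\<lambda>p. (fst p, snd (snd p))"] by auto
    from computes_pair[OF computes_weaken[OF this, where g' = "\<lambda>p. enc_list (fst (snd p))"]
        computes_head[OF pos]]
    show "computes ?B
        (\<lambda>p. Dot (enc_list (fst (snd p))) (Dot (el (fst p) (snd (snd p))) (f (fst p))))
        (\<lambda>p. enc_list (h (fst p) (snd (snd p)) # fst (snd p))) (\<lambda>p. U (fst p))"
      by simp
  qed
  moreover have "foldr (\<lambda>x ys. h i x # ys) l [] = map (h i) l" for i l
    by (induction l) auto
  ultimately show ?thesis by simp
qed

text \<open>A loop runs through one list only; the rest of the second list travels in the state,
  together with the reversed result.\<close>

lemma computes_zip:
  assumes "computes A f (\<lambda>i. enc_list (map (a i) (xs i))) T"
    and "computes A f (\<lambda>i. enc_list (map (b i) (xs i))) T"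
    and len: "\<And>i. i \<in> A \<Longrightarrow> length (xs i) \<le> C * T i"
  shows "computes A f (\<lambda>i. enc_list (map (\<lambda>x. Dot (a i x) (b i x)) (xs i))) T"
proof -
  let ?R = "\<lambda>i j. enc_list (rev (map (\<lambda>x. Dot (a i x) (b i x)) (take j (xs i))))"
  let ?st = "\<lambda>i j. Dot (enc_list (map (b i) (drop j (xs i)))) (?R i j)"
  have "computes A f (\<lambda>i. ?st i (length (xs i))) T"
  proof (rule computes_fold[where el = "\<lambda>i j. a i (xs i ! j)" and st = ?st
        and U = "\<lambda>_. 1" and C = C])
    show "computes A f (\<lambda>i. ?st i 0) T"
      using computes_pair[OF assms(2) computes_const[of A T f Nil_tree]]
        computes_time_pos[OF assms(1)] by simp
    show "computes A f (\<lambda>i. enc_list (map (\<lambda>j. a i (xs i ! j)) [0..<length (xs i)])) T"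
      by (rule computes_cong[OF assms(1)])
        (metis (no_types, lifting) map_nth map_map comp_apply map_cong)
    show "computes {(i, j). i \<in> A \<and> j < length (xs i)}
        (\<lambda>p. Dot (?st (fst p) (snd p)) (Dot (a (fst p) (xs (fst p) ! snd p)) (f (fst p))))
        (\<lambda>p. ?st (fst p) (Suc (snd p))) (\<lambda>p. 1)"
    proof (rule computes_expr[where e = "ConsE (TlE (HdE (HdE (Var 0))))
        (ConsE (ConsE (HdE (TlE (Var 0))) (HdE (HdE (HdE (Var 0))))) (TlE (HdE (Var 0))))"])
      fix p and s :: store
      assume p: "p \<in> {(i, j). i \<in> A \<and> j < length (xs i)}"
        and s: "s 0 = Dot (?st (fst p) (snd p)) (Dot (a (fst p) (xs (fst p) ! snd p)) (f (fst p)))"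
      obtain i j where ij: "p = (i, j)" "j < length (xs i)" using p by auto
      then have "drop j (xs i) = xs i ! j # drop (Suc j) (xs i)" by (simp add: Cons_nth_drop_Suc)
      with ij s show "eval_expr (ConsE (TlE (HdE (HdE (Var 0))))
        (ConsE (ConsE (HdE (TlE (Var 0))) (HdE (HdE (HdE (Var 0))))) (TlE (HdE (Var 0))))) s
        = ?st (fst p) (Suc (snd p))" by (simp add: take_Suc_conv_app_nth)
    qed simp
  qed (use len in auto)
  from computes_rev[OF computes_snd[OF this], of C] show ?thesis
    using len by (simp add: rev_map)
qed

lemma computes_select:
  assumes "computes A f (\<lambda>i. enc_list (map (a i) (xs i))) T"
    and "computes A f (\<lambda>i. enc_list (map (\<lambda>x. enc_bool (q i x)) (xs i))) T"
    and len: "\<And>i. i \<in> A \<Longrightarrow> length (xs i) \<le> C * T i"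
  shows "computes A f (\<lambda>i. enc_list (map (a i) (filter (q i) (xs i)))) T"
proof -
  have zip: "computes A f (\<lambda>i. enc_list (map (\<lambda>x. Dot (enc_bool (q i x)) (a i x)) (xs i))) T"
    by (rule computes_zip[OF assms(2,1) len])
  let ?h = "\<lambda>i x ys. if q i x then a i x # ys else ys"
  let ?B = "{(i, s, x). i \<in> A \<and> x \<in> set (xs i)}"
  have "computes A f (\<lambda>i. enc_list (foldr (?h i) (xs i) [])) T"
  proof (rule computes_foldr[OF _ zip, where st = "\<lambda>_. enc_list" and U = "\<lambda>_. 1" and C = C])
    show "computes A f (\<lambda>i. enc_list []) T"
      by (rule computes_const) (rule computes_time_pos[OF zip])
    let ?f = "\<lambda>p. Dot (enc_list (fst (snd p)))
      (Dot (Dot (enc_bool (q (fst p) (snd (snd p)))) (a (fst p) (snd (snd p)))) (f (fst p)))"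
    have "computes ?B ?f (\<lambda>p. if q (fst p) (snd (snd p)) then
        Dot (a (fst p) (snd (snd p))) (enc_list (fst (snd p))) else enc_list (fst (snd p))) (\<lambda>p. 1)"
    proof (rule computes_if_bool)
      show "computes ?B ?f (\<lambda>p. enc_bool (q (fst p) (snd (snd p)))) (\<lambda>p. 1)"
        by (rule computes_expr[where e = "HdE (HdE (TlE (Var 0)))"]) auto
      show "computes {p \<in> ?B. q (fst p) (snd (snd p))} ?f
          (\<lambda>p. Dot (a (fst p) (snd (snd p))) (enc_list (fst (snd p)))) (\<lambda>p. 1)"
        by (rule computes_expr[where e = "ConsE (TlE (HdE (TlE (Var 0)))) (HdE (Var 0))"]) auto
    qed (rule computes_head, simp)
    then show "computes ?B ?f (\<lambda>p. enc_list (?h (fst p) (snd (snd p)) (fst (snd p)))) (\<lambda>p. 1)"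
      by (rule computes_cong) auto
  qed (use len in auto)
  moreover have "foldr (?h i) l [] = map (a i) (filter (q i) l)" for i l
    by (induction l) auto
  ultimately show ?thesis by simp
qed

text \<open>Lengths serve as unary numbers: this is truncated subtraction, from which the comparison
  of cardinalities follows.\<close>

lemma computes_drop:
  assumes "computes A f (\<lambda>i. enc_list (xs i)) T" "computes A f (\<lambda>i. enc_list (ys i)) T"
    and len: "\<And>i. i \<in> A \<Longrightarrow> length (xs i) \<le> C * T i"
  shows "computes A f (\<lambda>i. enc_list (drop (length (xs i)) (ys i))) T"
proof (rule computes_fold[where st = "\<lambda>i j. enc_list (drop j (ys i))" and U = "\<lambda>_. 1"
      and C = C and el = "\<lambda>i j. xs i ! j"])
  have [simp]: "tl_tree (enc_list l) = enc_list (tl l)" for l by (cases l) auto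
  show "computes {(i, j). i \<in> A \<and> j < length (xs i)}
      (\<lambda>p. Dot (enc_list (drop (snd p) (ys (fst p)))) (Dot (xs (fst p) ! snd p) (f (fst p))))
      (\<lambda>p. enc_list (drop (Suc (snd p)) (ys (fst p)))) (\<lambda>p. 1)"
    by (rule computes_expr[where e = "TlE (HdE (Var 0))"]) (auto simp: drop_Suc drop_tl)
qed (use assms in \<open>auto simp: map_nth\<close>)

section \<open>Vertex sets and graphs\<close>

text \<open>If \<open>op False False\<close> holds, the resulting set reaches beyond the vertices;
  its encoding ignores that part.\<close>

lemma computes_set_op:
  fixes op :: "bool \<Rightarrow> bool \<Rightarrow> bool"
  assumes "computes A f (\<lambda>i. enc_set (n i) (X i)) T" "computes A f (\<lambda>i. enc_set (n i) (Y i)) T"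
    and n: "\<And>i. i \<in> A \<Longrightarrow> n i \<le> C * T i"
  shows "computes A f (\<lambda>i. enc_set (n i) {v. op (v \<in> X i) (v \<in> Y i)}) T"
proof -
  let ?el = "\<lambda>i v. Dot (enc_bool (v \<in> X i)) (enc_bool (v \<in> Y i))"
  have zip: "computes A f (\<lambda>i. enc_list (map (?el i) [0..<n i])) T"
    by (rule computes_zip[OF assms(1,2)[unfolded enc_set_def], of C]) (use n in auto)
  have "computes A f (\<lambda>i. enc_list (map (\<lambda>v. enc_bool (op (v \<in> X i) (v \<in> Y i))) [0..<n i])) T"
  proof (rule computes_map[OF zip, where U = "\<lambda>_. 1" and C = C])
    let ?B = "{(i, v). i \<in> A \<and> v \<in> set [0..<n i]}"
    have *: "computes ?B (\<lambda>p. Dot (?el (fst p) (snd p)) (f (fst p))) (\<lambda>p. ?el (fst p) (snd p)) (\<lambda>_. 1)"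
      by (rule computes_head) simp
    show "computes ?B (\<lambda>p. Dot (?el (fst p) (snd p)) (f (fst p)))
      (\<lambda>p. enc_bool (op (snd p \<in> X (fst p)) (snd p \<in> Y (fst p)))) (\<lambda>_. 1)"
      by (rule computes_bool_op[OF computes_fst[OF *] computes_snd[OF *]])
  qed (use n in auto)
  then show ?thesis by (simp add: enc_set_def)
qed

lemma card_members: "length (filter (\<lambda>v. v \<in> X) [0..<n]) = card (X \<inter> {..<n})"
proof -
  have "length (filter (\<lambda>v. v \<in> X) [0..<n]) = card (set (filter (\<lambda>v. v \<in> X) [0..<n]))"
    by (intro distinct_card[symmetric]) simp
  also have "set (filter (\<lambda>v. v \<in> X) [0..<n]) = X \<inter> {..<n}" by auto
  finally show ?thesis .
qed

text \<open>Filtering a characteristic vector by itself leaves one true entry per element: the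
  cardinality in unary.\<close>

lemma computes_card:
  assumes "computes A f (\<lambda>i. enc_set (n i) (X i)) T" and n: "\<And>i. i \<in> A \<Longrightarrow> n i \<le> C * T i"
  shows "computes A f (\<lambda>i. enc_list (replicate (card (X i \<inter> {..<n i})) (enc_bool True))) T"
proof -
  note X = assms(1)[unfolded enc_set_def]
  have "computes A f (\<lambda>i. enc_list (map (\<lambda>v. enc_bool (v \<in> X i)) (filter (\<lambda>v. v \<in> X i) [0..<n i]))) T"
    by (rule computes_select[OF X X, of C]) (use n in auto)
  moreover have "map (\<lambda>v. enc_bool (v \<in> Y)) (filter (\<lambda>v. v \<in> Y) [0..<m])
      = replicate (card (Y \<inter> {..<m})) (enc_bool True)" for Y :: "nat set" and m
    unfolding card_members[symmetric] by (rule map_replicate_const[THEN trans[rotated]]) auto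
  ultimately show ?thesis by simp
qed

lemma enc_list_eq_Nil [simp]: "enc_list xs = Nil_tree \<longleftrightarrow> xs = []"
  by (cases xs) auto

lemma computes_nonempty:
  assumes "computes A f (\<lambda>i. enc_set (n i) (X i)) T" and n: "\<And>i. i \<in> A \<Longrightarrow> n i \<le> C * T i"
  shows "computes A f (\<lambda>i. enc_bool (X i \<inter> {..<n i} \<noteq> {})) T"
proof -
  note pos = computes_time_pos[OF assms(1)]
  have "computes A f (\<lambda>i. if enc_list (replicate (card (X i \<inter> {..<n i})) (enc_bool True)) \<noteq> Nil_tree
      then enc_bool True else enc_bool False) T"
    by (rule computes_if[OF computes_card[OF assms]]) (auto intro!: computes_const pos)
  then show ?thesis by (rule computes_cong) (auto simp: card_eq_0_iff)
qed

lemma computes_card_less: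
  assumes "computes A f (\<lambda>i. enc_set (n i) (X i)) T" "computes A f (\<lambda>i. enc_set (n i) (Y i)) T"
    and n: "\<And>i. i \<in> A \<Longrightarrow> n i \<le> C * T i"
    and sub: "\<And>i. i \<in> A \<Longrightarrow> X i \<subseteq> {..<n i}" "\<And>i. i \<in> A \<Longrightarrow> Y i \<subseteq> {..<n i}"
  shows "computes A f (\<lambda>i. enc_bool (card (X i) < card (Y i))) T"
proof -
  note pos = computes_time_pos[OF assms(1)]
  let ?u = "\<lambda>X. replicate (card X) (enc_bool True)"
  have X: "computes A f (\<lambda>i. enc_list (?u (X i))) T"
    by (rule computes_cong[OF computes_card[OF assms(1), of C]]) (use n sub in \<open>auto simp: Int_absorb2\<close>)
  have Y: "computes A f (\<lambda>i. enc_list (?u (Y i))) T"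
    by (rule computes_cong[OF computes_card[OF assms(2), of C]]) (use n sub in \<open>auto simp: Int_absorb2\<close>)
  have "card (X i) \<le> n i" if "i \<in> A" for i
    using card_mono[OF _ sub(1)[OF that]] by simp
  then have len: "length (?u (X i)) \<le> C * T i" if "i \<in> A" for i
    using n[OF that] that by fastforce
  have "computes A f (\<lambda>i. if enc_list (drop (length (?u (X i))) (?u (Y i))) \<noteq> Nil_tree
      then enc_bool True else enc_bool False) T"
    by (rule computes_if[OF computes_drop[OF X Y len]]) (auto intro!: computes_const pos)
  then show ?thesis by (rule computes_cong) auto
qed

section \<open>Neighbourhoods and renumbered induced subgraphs\<close>

definition nbrs :: "ugraph \<Rightarrow> nat set \<Rightarrow> nat set" where
  "nbrs G X = {v. \<exists>u\<in>X. {v, u} \<in> edges G}"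

definition row :: "nat \<Rightarrow> ugraph \<Rightarrow> nat \<Rightarrow> tree" where
  "row n G v = enc_set n {u. {v, u} \<in> edges G}"

lemma enc_graph_rows: "enc_graph n G = enc_list (map (row n G) [0..<n])"
  by (simp add: enc_graph_def row_def[abs_def] enc_set_def)

text \<open>A vertex has a neighbour in \<open>X i\<close> iff its row of the adjacency matrix meets
  \<open>X i\<close>; each of the \<open>n i\<close> rows costs time linear in
  \<open>n i\<close>.\<close>

lemma computes_nbrs:
  assumes "computes A f (\<lambda>i. enc_graph (n i) (G i)) T" "computes A f (\<lambda>i. enc_set (n i) (X i)) T"
    and n: "\<And>i. i \<in> A \<Longrightarrow> n i * n i \<le> C * T i"
    and sub: "\<And>i. i \<in> A \<Longrightarrow> X i \<subseteq> {..<n i}"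
  shows "computes A f (\<lambda>i. enc_set (n i) (nbrs (G i) (X i))) T"
proof (rule computes_let[OF assms(2)])
  let ?f = "\<lambda>i. Dot (enc_set (n i) (X i)) (f i)"
  have list: "computes A ?f (\<lambda>i. enc_list (map (row (n i) (G i)) [0..<n i])) T"
    using computes_weaken[OF assms(1)] by (simp add: enc_graph_rows)
  have "computes A ?f (\<lambda>i. enc_list (map (\<lambda>v. enc_bool ({u. {v, u} \<in> edges (G i) \<and> u \<in> X i} \<inter> {..<n i} \<noteq> {})) [0..<n i])) T"
  proof (rule computes_map[OF list, where U = n and C = C])
    let ?B = "{(i, v). i \<in> A \<and> v \<in> set [0..<n i]}"
    let ?g = "\<lambda>p. Dot (row (n (fst p)) (G (fst p)) (snd p)) (Dot (enc_set (n (fst p)) (X (fst p))) (f (fst p)))"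
    have pos: "0 < n (fst p)" if "p \<in> ?B" for p using that by auto
    have "computes ?B ?g (\<lambda>p. enc_set (n (fst p)) {u. {snd p, u} \<in> edges (G (fst p))}) (\<lambda>p. n (fst p))"
      unfolding row_def by (rule computes_head[OF pos])
    moreover have "computes ?B ?g (\<lambda>p. enc_set (n (fst p)) (X (fst p))) (\<lambda>p. n (fst p))"
      by (rule computes_weaken, rule computes_head[OF pos])
    ultimately have "computes ?B ?g (\<lambda>p. enc_set (n (fst p))
        {u. u \<in> {u. {snd p, u} \<in> edges (G (fst p))} \<and> u \<in> X (fst p)}) (\<lambda>p. n (fst p))"
      by (rule computes_set_op[where C = 1]) simp
    then have "computes ?B ?g (\<lambda>p. enc_bool (
        {u. u \<in> {u. {snd p, u} \<in> edges (G (fst p))} \<and> u \<in> X (fst p)} \<inter> {..<n (fst p)} \<noteq> {})) (\<lambda>p. n (fst p))"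
      by (rule computes_nonempty[where C = 1]) simp
    then show "computes ?B ?g (\<lambda>p. enc_bool ({u. {snd p, u} \<in> edges (G (fst p)) \<and> u \<in> X (fst p)}
        \<inter> {..<n (fst p)} \<noteq> {})) (\<lambda>p. n (fst p))" by simp
  qed (use n in auto)
  then show "computes A ?f (\<lambda>i. enc_set (n i) (nbrs (G i) (X i))) T"
    unfolding enc_set_def
  proof (rule computes_cong)
    fix i assume "i \<in> A"
    then have "{u. {v, u} \<in> edges (G i) \<and> u \<in> X i} \<inter> {..<n i} \<noteq> {} \<longleftrightarrow> v \<in> nbrs (G i) (X i)" for v
      using sub by (auto simp: nbrs_def)
    then show "enc_list (map (\<lambda>v. enc_bool ({u. {v, u} \<in> edges (G i) \<and> u \<in> X i} \<inter> {..<n i} \<noteq> {})) [0..<n i])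
      = enc_list (map (\<lambda>v. enc_bool (v \<in> nbrs (G i) (X i))) [0..<n i])" by simp
  qed
qed

definition members :: "nat \<Rightarrow> nat set \<Rightarrow> nat list" where
  "members n X = filter (\<lambda>v. v \<in> X) [0..<n]"

lemma members_props [simp]:
  "set (members n X) = X \<inter> {..<n}" "distinct (members n X)" "length (members n X) = card (X \<inter> {..<n})"
  by (auto simp: members_def card_members)

text \<open>Up to isomorphism, the subgraph induced by a repetition-free list of vertices.
  Renumbering by positions gives the vertex set \<open>{..<k}\<close> that the given programs
  expect.\<close>

definition compress :: "ugraph \<Rightarrow> nat list \<Rightarrow> ugraph" where
  "compress G xs = Graph {..<length xs}
     {{a, b} |a b. a < length xs \<and> b < length xs \<and> {xs ! a, xs ! b} \<in> edges G}"

lemma edges_compress: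
  "a < length xs \<Longrightarrow> b < length xs \<Longrightarrow> {a, b} \<in> edges (compress G xs) \<longleftrightarrow> {xs ! a, xs ! b} \<in> edges G"
  by (auto simp: compress_def doubleton_eq_iff insert_commute)

lemma verts_compress [simp]: "verts (compress G xs) = {..<length xs}"
  by (simp add: compress_def)

lemma enc_graph_compress:
  "enc_graph (length xs) (compress G xs)
     = enc_list (map (\<lambda>u. enc_list (map (\<lambda>v. enc_bool ({u, v} \<in> edges G)) xs)) xs)"
proof -
  have *: "map g xs = map (\<lambda>a. g (xs ! a)) [0..<length xs]" for g :: "nat \<Rightarrow> tree"
    by (metis (no_types, lifting) map_nth map_map comp_apply map_cong)
  have "map (\<lambda>u. enc_list (map (\<lambda>v. enc_bool ({u, v} \<in> edges G)) xs)) xs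
      = map (\<lambda>a. enc_list (map (\<lambda>b. enc_bool ({xs ! a, xs ! b} \<in> edges G)) [0..<length xs])) [0..<length xs]"
    by (subst (1 2) *) (rule refl)
  then show ?thesis unfolding enc_graph_def
    by (simp only:) (intro arg_cong[where f = enc_list] map_cong refl, simp add: edges_compress)
qed

text \<open>The rows of the members of \<open>X i\<close> are selected from the matrix, and then the
  same columns within each row.\<close>

lemma computes_compress:
  assumes "computes A f (\<lambda>i. enc_graph (n i) (G i)) T" "computes A f (\<lambda>i. enc_set (n i) (X i)) T"
    and n: "\<And>i. i \<in> A \<Longrightarrow> Suc (n i) * Suc (n i) \<le> C * T i"
  shows "computes A f (\<lambda>i. enc_graph (card (X i \<inter> {..<n i})) (compress (G i) (members (n i) (X i)))) T"
proof (rule computes_let[OF assms(2)])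
  let ?f = "\<lambda>i. Dot (enc_set (n i) (X i)) (f i)"
  let ?el = "\<lambda>i. row (n i) (G i)"
  have n': "n i \<le> C * T i" if "i \<in> A" for i
    using n[OF that] by simp
  have "computes A ?f (\<lambda>i. enc_list (map (?el i) [0..<n i])) T"
    using computes_weaken[OF assms(1)] by (simp add: enc_graph_rows)
  moreover have "computes A ?f (\<lambda>i. enc_list (map (\<lambda>v. enc_bool (v \<in> X i)) [0..<n i])) T"
    using computes_head[OF computes_time_pos[OF assms(1)]] by (simp add: enc_set_def)
  ultimately have list: "computes A ?f (\<lambda>i. enc_list (map (?el i) (members (n i) (X i)))) T"
    unfolding members_def by (rule computes_select[where C = C]) (simp add: n')
  let ?h = "\<lambda>i u. enc_list (map (\<lambda>v. enc_bool ({u, v} \<in> edges (G i))) (members (n i) (X i)))"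
  have "computes A ?f (\<lambda>i. enc_list (map (?h i) (members (n i) (X i)))) T"
  proof (rule computes_map[OF list, where U = "\<lambda>i. Suc (n i)" and C = C])
    let ?B = "{(i, v). i \<in> A \<and> v \<in> set (members (n i) (X i))}"
    let ?g = "\<lambda>p. Dot (row (n (fst p)) (G (fst p)) (snd p)) (Dot (enc_set (n (fst p)) (X (fst p))) (f (fst p)))"
    have "computes ?B ?g (\<lambda>p. enc_list (map (\<lambda>v. enc_bool ({snd p, v} \<in> edges (G (fst p)))) [0..<n (fst p)]))
        (\<lambda>p. Suc (n (fst p)))"
      unfolding row_def enc_set_def mem_Collect_eq by (rule computes_head) simp
    moreover have "computes ?B ?g (\<lambda>p. enc_list (map (\<lambda>v. enc_bool (v \<in> X (fst p))) [0..<n (fst p)]))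
        (\<lambda>p. Suc (n (fst p)))"
      unfolding enc_set_def by (rule computes_weaken, rule computes_head) simp
    ultimately show "computes ?B ?g (\<lambda>p. ?h (fst p) (snd p)) (\<lambda>p. Suc (n (fst p)))"
      unfolding members_def by (rule computes_select[where C = 1]) simp
  next
    fix i assume i: "i \<in> A"
    have "length (members (n i) (X i)) \<le> Suc (n i)"
      unfolding members_def by (rule order_trans[OF length_filter_le]) simp
    then have "length (members (n i) (X i)) * Suc (n i) \<le> Suc (n i) * Suc (n i)"
      by (rule mult_le_mono1)
    then show "length (members (n i) (X i)) * Suc (n i) \<le> C * T i" using n[OF i] by linarith
  qed
  then show "computes A ?f (\<lambda>i. enc_graph (card (X i \<inter> {..<n i})) (compress (G i) (members (n i) (X i)))) T"
    using enc_graph_compress[of "members (n i) (X i)" "G i" for i] by simp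
qed

lemma members_Suc: "members (Suc j) X = members j X @ (if j \<in> X then [j] else [])"
  by (simp add: members_def)

text \<open>\<open>length (members j X)\<close> is the rank of \<open>j\<close> in \<open>X\<close>,
  the number of smaller elements, and hence the number that \<open>j\<close> gets in the
  renumbering.\<close>

lemma nth_members_length:
  assumes "j < n" "j \<in> X"
  shows "members n X ! length (members j X) = j" "length (members j X) < length (members n X)"
proof -
  obtain k where n: "n = Suc j + k" using assms(1) less_iff_Suc_add by auto
  have eq: "members n X = members j X @ j # filter (\<lambda>v. v \<in> X) [Suc j..<n]"
    unfolding members_def n upt_add_eq_append[OF le0] using assms(2) by simp
  show "members n X ! length (members j X) = j" "length (members j X) < length (members n X)"
    unfolding eq by (simp_all add: nth_append del: members_props)
qed

text \<open>Translates an answer for the renumbered subgraph back to vertices of the graph. In one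
  pass over the vector of \<open>X i\<close>, each member takes the next entry of the vector of
  \<open>J i\<close>, and each other vertex gets a false entry.\<close>

lemma computes_expand:
  assumes "computes A f (\<lambda>i. enc_set (n i) (X i)) T"
    and "computes A f (\<lambda>i. enc_set (length (members (n i) (X i))) (J i)) T"
    and n: "\<And>i. i \<in> A \<Longrightarrow> n i \<le> C * T i"
    and J: "\<And>i. i \<in> A \<Longrightarrow> J i \<subseteq> {..<length (members (n i) (X i))}"
  shows "computes A f (\<lambda>i. enc_set (n i) ((!) (members (n i) (X i)) ` J i)) T"
proof -
  let ?l = "\<lambda>i. members (n i) (X i)"
  let ?Y = "\<lambda>i. (!) (?l i) ` J i"
  let ?R = "\<lambda>i j. enc_list (map (\<lambda>a. enc_bool (a \<in> J i)) [length (members j (X i))..<length (?l i)])"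
  let ?S = "\<lambda>i j. enc_list (rev (map (\<lambda>v. enc_bool (v \<in> ?Y i)) [0..<j]))"
  \<comment> \<open>This turns the image into a test on the rank, which is the position reached in
    the vector of \<open>J i\<close>.\<close>
  have mem: "j \<in> ?Y i \<longleftrightarrow> j \<in> X i \<and> length (members j (X i)) \<in> J i" if "i \<in> A" "j < n i" for i j
  proof
    assume "j \<in> ?Y i"
    then obtain a where a: "a \<in> J i" "j = ?l i ! a" by auto
    then have a': "a < length (?l i)" using J[OF that(1)] by auto
    then have "j \<in> X i" using a(2) nth_mem[of a "?l i"] members_props(1) by blast
    moreover have "a = length (members j (X i))"
      using nth_members_length[OF that(2) \<open>j \<in> X i\<close>] a(2)[symmetric] a'
        nth_eq_iff_index_eq[OF members_props(2), of a "n i" "X i" "length (members j (X i))"]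
      by (simp del: members_props)
    ultimately show "j \<in> X i \<and> length (members j (X i)) \<in> J i" using a(1) by blast
  next
    assume "j \<in> X i \<and> length (members j (X i)) \<in> J i"
    then show "j \<in> ?Y i" using nth_members_length(1)[OF that(2), of "X i"]
      by (intro image_eqI[of _ _ "length (members j (X i))"]) (simp_all del: members_props)
  qed
  have "computes A f (\<lambda>i. Dot (?R i (n i)) (?S i (n i))) T"
  proof (rule computes_fold[where el = "\<lambda>i v. enc_bool (v \<in> X i)" and st = "\<lambda>i j. Dot (?R i j) (?S i j)"
        and U = "\<lambda>_. 1" and C = C])
    show "computes A f (\<lambda>i. Dot (?R i 0) (?S i 0)) T"
      using computes_pair[OF assms(2) computes_const[of A T f Nil_tree]] computes_time_pos[OF assms(1)]
      by (simp add: enc_set_def members_def)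
    show "computes A f (\<lambda>i. enc_list (map (\<lambda>v. enc_bool (v \<in> X i)) [0..<n i])) T"
      using assms(1) by (simp add: enc_set_def)
    let ?B = "{(i, j). i \<in> A \<and> j < n i}"
    let ?g = "\<lambda>p. Dot (Dot (?R (fst p) (snd p)) (?S (fst p) (snd p)))
      (Dot (enc_bool (snd p \<in> X (fst p))) (f (fst p)))"
    have "computes ?B ?g (\<lambda>p. if snd p \<in> X (fst p)
      then Dot (tl_tree (?R (fst p) (snd p))) (Dot (hd_tree (?R (fst p) (snd p))) (?S (fst p) (snd p)))
      else Dot (?R (fst p) (snd p)) (Dot Nil_tree (?S (fst p) (snd p)))) (\<lambda>_. 1)"
      (is "computes _ _ (\<lambda>p. if _ then ?P p else ?Q p) _")
    proof (rule computes_if_bool)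
      show "computes ?B ?g (\<lambda>p. enc_bool (snd p \<in> X (fst p))) (\<lambda>_. 1)"
        by (rule computes_weaken, rule computes_head) simp
      show "computes {p \<in> ?B. snd p \<in> X (fst p)} ?g ?P (\<lambda>_. 1)"
        by (rule computes_expr[where e = "ConsE (TlE (HdE (HdE (Var 0))))
          (ConsE (HdE (HdE (HdE (Var 0)))) (TlE (HdE (Var 0))))"]) auto
      show "computes {p \<in> ?B. snd p \<notin> X (fst p)} ?g ?Q (\<lambda>_. 1)"
        by (rule computes_expr[where e = "ConsE (HdE (HdE (Var 0))) (ConsE NilE (TlE (HdE (Var 0))))"]) auto
    qed
    then show "computes ?B ?g (\<lambda>p. Dot (?R (fst p) (Suc (snd p))) (?S (fst p) (Suc (snd p)))) (\<lambda>_. 1)"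
    proof (rule computes_cong)
      fix p assume "p \<in> ?B"
      then obtain i j where p: "p = (i, j)" "i \<in> A" "j < n i" by auto
      show "(if snd p \<in> X (fst p) then ?P p else ?Q p) = Dot (?R (fst p) (Suc (snd p))) (?S (fst p) (Suc (snd p)))"
      proof (cases "j \<in> X i")
        case True
        have "[length (members j (X i))..<length (?l i)]
            = length (members j (X i)) # [length (members (Suc j) (X i))..<length (?l i)]"
          using nth_members_length(2)[OF p(3) True] True
          by (simp add: upt_conv_Cons members_Suc del: members_props)
        then show ?thesis using True p mem[OF p(2,3)] by (simp del: members_props)
      next
        case False
        then have "members (Suc j) (X i) = members j (X i)" by (simp add: members_Suc)
        then show ?thesis using False p mem[OF p(2,3)]
          by (simp del: members_props add: enc_bool_def[of False])
      qed
    qed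
  qed (use n in auto)
  from computes_rev[OF computes_snd[OF this], of C] show ?thesis
    using n by (simp add: enc_set_def)
qed

section \<open>Enumeration of small vertex sets\<close>

lemma computes_singletons:
  assumes "computes A f (\<lambda>i. enc_list (map (el i) [0..<n i])) T"
    and n: "\<And>i. i \<in> A \<Longrightarrow> Suc (n i) * Suc (n i) \<le> C * T i"
  shows "computes A f (\<lambda>i. enc_list (map (\<lambda>v. enc_set (n i) {v}) [0..<n i])) T"
proof -
  \<comment> \<open>The program knows \<open>n i\<close> only as the length of a list, so the
    vectors grow with each list element: every old singleton is shifted by a leading false entry,
    and the vector of \<open>{0}\<close> is added. The empty set supplies the tail of that
    vector.\<close>
  let ?S = "\<lambda>j. enc_list (map (\<lambda>v. enc_set j {v}) [0..<j])"
  have "computes A f (\<lambda>i. Dot (enc_set (n i) {}) (?S (n i))) T"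
  proof (rule computes_fold[OF _ assms(1), where U = "\<lambda>i. Suc (n i)" and C = C
        and st = "\<lambda>_ j. Dot (enc_set j {}) (?S j)"])
    have "computes A f (\<lambda>i. Dot Nil_tree Nil_tree) T"
      by (rule computes_const) (rule computes_time_pos[OF assms(1)])
    then show "computes A f (\<lambda>i. Dot (enc_set 0 {}) (?S 0)) T"
      by (simp add: enc_set_def)
    let ?B = "{(i, j). i \<in> A \<and> j < n i}"
    let ?g = "\<lambda>p. Dot (Dot (enc_set (snd p) {}) (?S (snd p))) (Dot (el (fst p) (snd p)) (f (fst p)))"
    let ?U = "\<lambda>p. Suc (n (fst p))"
    have "computes ?B ?g (\<lambda>p. enc_list (map (\<lambda>v. Dot Nil_tree (enc_set (snd p) {v})) [0..<snd p])) ?U"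
    proof (rule computes_map[where U = "\<lambda>_. 1" and C = 1 and el = "\<lambda>p v. enc_set (snd p) {v}"])
      show "computes ?B ?g (\<lambda>p. ?S (snd p)) ?U"
        by (rule computes_snd, rule computes_head) simp
    qed (rule computes_expr[where e = "ConsE NilE (HdE (Var 0))"], auto)
    moreover have "computes ?B ?g (\<lambda>p. enc_set (snd p) {}) ?U"
      by (rule computes_fst, rule computes_head) simp
    moreover have "computes ?B ?g (\<lambda>p. t) ?U" for t by (rule computes_const) simp
    ultimately have "computes ?B ?g (\<lambda>p. Dot (Dot Nil_tree (enc_set (snd p) {}))
      (Dot (Dot (enc_bool True) (enc_set (snd p) {}))
        (enc_list (map (\<lambda>v. Dot Nil_tree (enc_set (snd p) {v})) [0..<snd p])))) ?U"
      by (intro computes_pair)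
    then show "computes ?B ?g (\<lambda>p. Dot (enc_set (Suc (snd p)) {}) (?S (Suc (snd p)))) ?U"
      by (simp add: enc_set_def map_upt_Suc enc_bool_def del: upt_Suc cong: map_cong)
  next
    fix i assume "i \<in> A"
    then show "n i * Suc (n i) \<le> C * T i" using n[of i] by simp
  qed
  then show ?thesis by (rule computes_snd)
qed

text \<open>All sets \<open>X \<subseteq> {..<n}\<close> with \<open>1 \<le> card X \<le> k\<close>, with repetitions; the empty set is listed only for
  \<open>k = 0\<close>.\<close>

fun small_sets :: "nat \<Rightarrow> nat \<Rightarrow> nat set list" where
  "small_sets n 0 = [{}]"
| "small_sets n (Suc k) =
     foldl (\<lambda>Ys X. foldl (\<lambda>Ys v. insert v X # Ys) Ys [0..<n]) [] (small_sets n k)"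

lemma foldl_Cons_map: "foldl (\<lambda>ys x. g x # ys) ys xs = rev (map g xs) @ ys"
  by (induction xs arbitrary: ys) auto

lemma foldl_append_rev: "foldl (\<lambda>ys x. rev (g x) @ ys) ys xs = rev (concat (map g xs)) @ ys"
  by (induction xs arbitrary: ys) auto

lemma small_sets_Suc:
  "small_sets n (Suc k) = rev (concat (map (\<lambda>X. map (\<lambda>v. insert v X) [0..<n]) (small_sets n k)))"
  by (simp add: foldl_Cons_map foldl_append_rev)

lemma length_small_sets: "length (small_sets n k) = n ^ k"
proof (induction k)
  case (Suc k)
  have "length (concat (map (\<lambda>X. map (\<lambda>v. insert v X) [0..<n]) Xs)) = n * length Xs" for Xs
    by (induction Xs) auto
  then show ?case using Suc by (simp add: small_sets_Suc del: small_sets.simps(2))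
qed simp

lemma set_small_sets:
  "X \<in> set (small_sets n k) \<Longrightarrow> X \<subseteq> {..<n}"
  by (induction k arbitrary: X) (fastforce simp: small_sets_Suc simp del: small_sets.simps(2))+

lemma small_sets_complete:
  assumes "X \<subseteq> {..<n}" "X \<noteq> {}" "card X \<le> k"
  shows "X \<in> set (small_sets n k)"
  using assms
proof (induction k arbitrary: X)
  case 0
  then show ?case using finite_subset[OF 0(1)] by simp
next
  case (Suc k)
  have fin: "finite X" using Suc.prems(1) finite_subset by blast
  obtain v where v: "v \<in> X" using Suc.prems by blast
  obtain Y where Y: "Y \<in> set (small_sets n k)" "insert v Y = X"
  \<comment> \<open>For \<open>k > 0\<close> the empty set is not listed, so a singleton is built
    from itself by inserting \<open>v\<close> again; for \<open>k = 0\<close> it is built from the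
    empty set.\<close>
  proof (cases "X - {v} = {} ")
    case True
    show ?thesis
    proof (cases k)
      case 0
      then show ?thesis using that[of "{}"] True v by auto
    next
      case (Suc k')
      have "card X = 1" using True v by (metis Diff_eq_empty_iff card_1_singleton_iff insert_absorb2 subset_singletonD empty_iff One_nat_def)
      then have "X \<in> set (small_sets n k)" using Suc.IH[of X] Suc.prems Suc by simp
      then show ?thesis using that[of X] v by (simp add: insert_absorb)
    qed
  next
    case False
    then have "X - {v} \<in> set (small_sets n k)"
      using Suc.prems v fin by (intro Suc.IH) auto
    then show ?thesis using that[of "X - {v}"] v by (simp add: insert_absorb)
  qed
  have "X \<in> (\<lambda>v. insert v Y) ` {0..<n}"
    using v Suc.prems(1) Y(2) by (intro image_eqI[of _ _ v]) auto
  with Y(1) show ?case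
    by (auto simp: small_sets_Suc simp del: small_sets.simps(2))
qed

text \<open>The induction on \<open>k\<close> yields a separate program for each \<open>k\<close>,
  uniform in \<open>n\<close> only. From \<open>k\<close> to \<open>Suc k\<close>, each of
  \<open>n ^ k\<close> listed sets is united with \<open>n\<close> singletons, at a cost linear in
  \<open>n\<close> each time.\<close>

lemma computes_small_sets:
  "computes UNIV (\<lambda>n. enc_list (map (\<lambda>v. enc_set n {v}) [0..<n]))
     (\<lambda>n. enc_list (map (enc_set n) (small_sets n k))) (\<lambda>n. Suc n ^ (k + 2))"
proof (induction k)
  case 0
  let ?f = "\<lambda>n. enc_list (map (\<lambda>v. enc_set n {v}) [0..<n])"
  have "computes UNIV ?f (\<lambda>n. enc_list (map (\<lambda>v. Nil_tree) [0..<n])) (\<lambda>n. Suc n)"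
    by (rule computes_map[where U = "\<lambda>_. 1" and C = 1 and el = "\<lambda>n v. enc_set n {v}"])
      (auto intro!: computes_id computes_const)
  then have "computes UNIV ?f (\<lambda>n. enc_set n {}) (\<lambda>n. Suc n)"
    by (simp add: enc_set_def enc_bool_def)
  then have "computes UNIV ?f (\<lambda>n. Dot (enc_set n {}) Nil_tree) (\<lambda>n. Suc n)"
    by (rule computes_pair) (auto intro!: computes_const)
  then have "computes UNIV ?f (\<lambda>n. Dot (enc_set n {}) Nil_tree) (\<lambda>n. Suc n ^ (0 + 2))"
    by (rule computes_mono[where C = 1]) (simp add: power2_eq_square)
  then show ?case by simp
next
  case (Suc k)
  let ?f = "\<lambda>n. enc_list (map (\<lambda>v. enc_set n {v}) [0..<n])"
  let ?T = "\<lambda>n. Suc n ^ (Suc k + 2)"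
  let ?h = "\<lambda>n Ys X. foldl (\<lambda>Ys v. insert v X # Ys) Ys [0..<n]"
  have "computes UNIV ?f (\<lambda>n. enc_list (map (enc_set n) (foldl (?h n) [] (small_sets n k)))) ?T"
  proof (rule computes_foldl[where U = "\<lambda>n. Suc n ^ 2" and C = 1 and P = "\<lambda>_ _. True"
        and el = "\<lambda>n. enc_set n" and st = "\<lambda>n Xs. enc_list (map (enc_set n) Xs)"])
    show "computes UNIV ?f (\<lambda>i. enc_list (map (enc_set i) [])) ?T"
      using computes_const[of UNIV ?T ?f Nil_tree] by simp
    show "computes UNIV ?f (\<lambda>n. enc_list (map (enc_set n) (small_sets n k))) ?T"
      by (rule computes_mono[OF Suc, where C = 1]) simp
    let ?B = "{(n, s, X). n \<in> UNIV \<and> True \<and> X \<in> set (small_sets n k)}"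
    let ?g = "\<lambda>p. Dot (enc_list (map (enc_set (fst p)) (fst (snd p))))
      (Dot (enc_set (fst p) (snd (snd p))) (?f (fst p)))"
    show "computes ?B ?g (\<lambda>p. enc_list (map (enc_set (fst p)) (?h (fst p) (fst (snd p)) (snd (snd p)))))
      (\<lambda>p. Suc (fst p) ^ 2)"
    proof (rule computes_foldl[where U = "\<lambda>p. Suc (fst p)" and C = 1 and P = "\<lambda>_ _. True"
        and el = "\<lambda>p v. enc_set (fst p) {v}" and st = "\<lambda>p Xs. enc_list (map (enc_set (fst p)) Xs)"])
      show "computes ?B ?g (\<lambda>p. enc_list (map (enc_set (fst p)) (fst (snd p)))) (\<lambda>p. Suc (fst p) ^ 2)"
        by (rule computes_head) simp
      show "computes ?B ?g (\<lambda>p. ?f (fst p)) (\<lambda>p. Suc (fst p) ^ 2)"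
        by (rule computes_weaken, rule computes_weaken, rule computes_id) simp
      let ?B' = "{(i, s, x). i \<in> ?B \<and> True \<and> x \<in> set [0..<fst i]}"
      let ?g' = "\<lambda>p. Dot (enc_list (map (enc_set (fst (fst p))) (fst (snd p))))
        (Dot (enc_set (fst (fst p)) {snd (snd p)}) (?g (fst p)))"
      let ?U = "\<lambda>p. Suc (fst (fst p))"
      have "computes ?B' ?g' (\<lambda>p. enc_set (fst (fst p)) {snd (snd p)}) ?U"
        by (rule computes_weaken, rule computes_head) simp
      moreover have "computes ?B' ?g' (\<lambda>p. enc_set (fst (fst p)) (snd (snd (fst p)))) ?U"
        by (rule computes_weaken, rule computes_weaken, rule computes_weaken, rule computes_head) simp
      ultimately have "computes ?B' ?g' (\<lambda>p. enc_set (fst (fst p))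
        {v. v \<in> {snd (snd p)} \<or> v \<in> snd (snd (fst p))}) ?U"
        by (rule computes_set_op[where C = 1]) simp
      then have "computes ?B' ?g' (\<lambda>p. enc_set (fst (fst p)) (insert (snd (snd p)) (snd (snd (fst p))))) ?U"
        by (rule computes_cong) (simp add: enc_set_def)
      from computes_pair[OF this computes_head] show "computes ?B' ?g' (\<lambda>p. enc_list (map (enc_set (fst (fst p)))
          (insert (snd (snd p)) (snd (snd (fst p))) # fst (snd p)))) ?U"
        by simp
    qed (auto simp: power2_eq_square)
  next
    fix n :: nat
    have "length (small_sets n k) \<le> Suc n ^ k"
      unfolding length_small_sets by (intro power_mono) auto
    then have "length (small_sets n k) * Suc n ^ 2 \<le> Suc n ^ k * Suc n ^ 2" by (rule mult_le_mono1)
    also have "\<dots> = Suc n ^ (k + 2)" by (rule power_add[symmetric])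
    also have "\<dots> \<le> 1 * ?T n" by simp
    finally show "length (small_sets n k) * Suc n ^ 2 \<le> 1 * ?T n" .
  qed auto
  then show ?case by simp
qed

section \<open>Local search and enumeration\<close>

lemma isomorphic_sym:
  assumes "isomorphic G H"
  shows "isomorphic H G"
proof -
  obtain f where f: "bij_betw f (verts G) (verts H)"
    "\<forall>u\<in>verts G. \<forall>v\<in>verts G. {u, v} \<in> edges G \<longleftrightarrow> {f u, f v} \<in> edges H"
    using assms unfolding isomorphic_def by blast
  let ?g = "inv_into (verts G) f"
  have g: "bij_betw ?g (verts H) (verts G)" by (rule bij_betw_inv_into[OF f(1)])
  have "{u, v} \<in> edges H \<longleftrightarrow> {?g u, ?g v} \<in> edges G" if "u \<in> verts H" "v \<in> verts H" for u v
  proof -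
    have "?g u \<in> verts G" "?g v \<in> verts G" using g that by (auto dest: bij_betwE)
    moreover have "f (?g u) = u" "f (?g v) = v"
      using bij_betw_inv_into_right[OF f(1)] that by auto
    ultimately show ?thesis using f(2) by metis
  qed
  with g show ?thesis unfolding isomorphic_def by blast
qed

lemma verts_induced [simp]: "verts (induced G X) = verts G \<inter> X"
  by (simp add: induced_def)

lemma edges_induced [simp]: "edges (induced G X) = {e \<in> edges G. e \<subseteq> X}"
  by (simp add: induced_def)

lemma simple_induced: "simple_graph G \<Longrightarrow> simple_graph (induced G X)"
  by (auto simp: simple_graph_def)

lemma induced_induced: "Y \<subseteq> X \<Longrightarrow> induced (induced G X) Y = induced G Y"
  by (auto simp: induced_def)

lemma hereditary_induced:
  "hereditary C \<Longrightarrow> induced G X \<in> C \<Longrightarrow> X \<subseteq> verts G \<Longrightarrow> Y \<subseteq> X \<Longrightarrow> induced G Y \<in> C"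
  unfolding hereditary_def by (metis Int_absorb1 induced_induced verts_induced)

lemma simple_compress:
  assumes "simple_graph G"
  shows "simple_graph (compress G xs)"
  unfolding simple_graph_def
proof (intro conjI ballI)
  fix e assume "e \<in> edges (compress G xs)"
  then obtain a b where ab: "e = {a, b}" "a < length xs" "b < length xs" "{xs ! a, xs ! b} \<in> edges G"
    by (auto simp: compress_def)
  then have "card {xs ! a, xs ! b} = 2" using assms by (auto simp: simple_graph_def)
  then have "a \<noteq> b" by auto
  with ab show "e \<subseteq> verts (compress G xs)" "card e = 2" by auto
qed simp

lemma isomorphic_compress:
  assumes "distinct xs" "set xs = verts G \<inter> X"
  shows "isomorphic (compress G xs) (induced G X)"
  unfolding isomorphic_def
proof (intro exI conjI ballI)
  show "bij_betw ((!) xs) (verts (compress G xs)) (verts (induced G X))"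
    using assms by (auto intro: bij_betw_nth)
  fix u v assume "u \<in> verts (compress G xs)" "v \<in> verts (compress G xs)"
  then have uv: "u < length xs" "v < length xs" by auto
  then have "xs ! u \<in> X" "xs ! v \<in> X" using assms(2) nth_mem by blast+
  with uv show "{u, v} \<in> edges (compress G xs) \<longleftrightarrow> {xs ! u, xs ! v} \<in> edges (induced G X)"
    by (simp add: edges_compress)
qed

text \<open>Closure under isomorphism, used in both directions, lets the class be tested on the
  renumbered graph.\<close>

lemma compress_in_class:
  assumes "graph_class C" "simple_graph G" "distinct xs" "set xs = verts G \<inter> X"
  shows "compress G xs \<in> C \<longleftrightarrow> induced G X \<in> C"
proof -
  note iso = isomorphic_compress[OF assms(3,4)]
  have closed: "K \<in> C" if "H \<in> C" "simple_graph K" "isomorphic H K" for H K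
    using assms(1) that unfolding graph_class_def by blast
  show ?thesis
    using closed[OF _ simple_induced[OF assms(2)] iso]
      closed[OF _ simple_compress[OF assms(2)] isomorphic_sym[OF iso]] by blast
qed

text \<open>Positions in \<open>xs\<close> correspond to vertices in \<open>X\<close> with adjacency
  preserved, so independent sets inside \<open>X\<close> and those of the renumbered graph match
  with equal sizes.\<close>

lemma maximum_independent_compress:
  assumes "distinct xs" "set xs = verts G \<inter> X" "maximum_independent_set (compress G xs) I"
  shows "independent_set G ((!) xs ` I)" "(!) xs ` I \<subseteq> X"
    "\<And>J. independent_set G J \<Longrightarrow> J \<subseteq> X \<Longrightarrow> card J \<le> card ((!) xs ` I)"
proof -
  have I: "I \<subseteq> {..<length xs}" "\<And>u v. u \<in> I \<Longrightarrow> v \<in> I \<Longrightarrow> {u, v} \<notin> edges (compress G xs)"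
    using assms(3) by (auto simp: maximum_independent_set_def independent_set_def)
  have sub: "(!) xs ` I \<subseteq> verts G \<inter> X"
    using I(1) nth_mem[of _ xs] assms(2) by auto
  then show "(!) xs ` I \<subseteq> X" by simp
  have "{xs ! u, xs ! v} \<notin> edges G" if "u \<in> I" "v \<in> I" for u v
    using I(2)[OF that] that I(1) by (subst edges_compress[symmetric]) auto
  with sub show "independent_set G ((!) xs ` I)"
    by (auto simp: independent_set_def)
  fix J assume J: "independent_set G J" "J \<subseteq> X"
  let ?K = "{a. a < length xs \<and> xs ! a \<in> J}"
  have "{u, v} \<notin> edges (compress G xs)" if "u \<in> ?K" "v \<in> ?K" for u v
    using that J(1) by (subst edges_compress) (auto simp: independent_set_def)
  then have "independent_set (compress G xs) ?K" by (auto simp: independent_set_def)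
  then have "card ?K \<le> card I" using assms(3) by (auto simp: maximum_independent_set_def)
  moreover have "J = (!) xs ` ?K"
  proof
    have "J \<subseteq> set xs" using J assms(2) by (auto simp: independent_set_def)
    then show "J \<subseteq> (!) xs ` ?K" by (force simp: in_set_conv_nth)
  qed auto
  moreover have inj: "inj_on ((!) xs) {..<length xs}"
    using assms(1) by (simp add: inj_on_nth)
  have "card ((!) xs ` I) = card I" by (rule card_image[OF inj_on_subset[OF inj I(1)]])
  moreover have "card ((!) xs ` ?K) = card ?K"
    by (rule card_image[OF inj_on_subset[OF inj]]) auto
  ultimately show "card J \<le> card ((!) xs ` I)" by simp
qed

section \<open>Local search for a large sparse set\<close>

lemma sparse_dense_classesD:
  assumes "sparse_dense_classes c \<S> \<D>"
  shows "graph_class \<S>" "hereditary \<S>"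
    and "\<And>G S D. simple_graph G \<Longrightarrow> S \<subseteq> verts G \<Longrightarrow> D \<subseteq> verts G \<Longrightarrow>
      induced G S \<in> \<S> \<Longrightarrow> induced G D \<in> \<D> \<Longrightarrow> card (S \<inter> D) \<le> c"
  using assms unfolding sparse_dense_classes_def by simp_all

text \<open>The improved set is a subset of \<open>S\<close>, so heredity puts it into the sparse
  class. At most \<open>c\<close> vertices are dropped and \<open>c + 1\<close> added, which gives
  \<open>2 * c + 1\<close>.\<close>

lemma exchange:
  assumes classes: "sparse_dense_classes c \<S> \<D>" and G: "simple_graph G"
    and part: "sparse_dense_partition \<S> \<D> G S D"
    and S': "S' \<subseteq> verts G" "induced G S' \<in> \<S>" "card S' < card S"
  shows "\<exists>W\<subseteq>verts G. W \<noteq> {} \<and> card W \<le> 2 * c + 1 \<and>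
    card S' < card (sym_diff S' W) \<and> induced G (sym_diff S' W) \<in> \<S>"
proof -
  have SD: "S \<union> D = verts G" "S \<inter> D = {}" "induced G S \<in> \<S>" "induced G D \<in> \<D>"
    using part by (auto simp: sparse_dense_partition_def)
  have "finite (verts G)" using G by (simp add: simple_graph_def)
  then have fin: "finite S" "finite S'" "finite D"
    using SD(1) finite_subset[OF S'(1)] finite_Un[of S D] by simp_all
  have "S' - S = S' \<inter> D" using SD(1,2) S'(1) by auto
  moreover have "D \<subseteq> verts G" using SD(1) by auto
  ultimately have le: "card (S' - S) \<le> c"
    using sparse_dense_classesD(3)[OF classes G S'(1) _ S'(2) SD(4)] by simp
  have "card S' = card (S' - S) + card (S \<inter> S')" "card S = card (S - S') + card (S \<inter> S')"
    using card_Int_Diff[OF fin(1), of S'] card_Int_Diff[OF fin(2), of S]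
    by (simp_all add: Int_commute)
  then have "Suc (card (S' - S)) \<le> card (S - S')" using S'(3) by linarith
  then obtain F where F: "F \<subseteq> S - S'" "card F = Suc (card (S' - S))" "finite F"
    by (rule obtain_subset_with_card_n)
  let ?W = "(S' - S) \<union> F"
  have W: "card ?W = card (S' - S) + card F" using F fin by (intro card_Un_disjoint) auto
  have eq: "sym_diff S' ?W = (S \<inter> S') \<union> F" using F(1) by auto
  have "card (sym_diff S' ?W) = card (S \<inter> S') + card F"
    unfolding eq using F fin by (intro card_Un_disjoint) auto
  then have "card S' < card (sym_diff S' ?W)"
    using F(2) \<open>card S' = card (S' - S) + card (S \<inter> S')\<close> by linarith
  moreover have "induced G (sym_diff S' ?W) \<in> \<S>"
    unfolding eq
    by (rule hereditary_induced[OF sparse_dense_classesD(2)[OF classes] SD(3)]) (use SD(1) F(1) in auto)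
  moreover have "?W \<subseteq> verts G" "?W \<noteq> {}" "card ?W \<le> 2 * c + 1"
    using F W le SD(1) S'(1) by auto
  ultimately show ?thesis by blast
qed

text \<open>As a symmetric difference, one enumerated set describes both the vertices to drop and
  those to add.\<close>

definition swap :: "ugraph set \<Rightarrow> ugraph \<Rightarrow> nat set \<Rightarrow> nat set \<Rightarrow> nat set" where
  "swap \<S> G S W = (if card S < card (sym_diff S W) \<and> induced G (sym_diff S W) \<in> \<S>
     then sym_diff S W else S)"

lemma card_swap: "card S \<le> card (swap \<S> G S W)"
  by (simp add: swap_def)

lemma swap_subset: "S \<subseteq> V \<Longrightarrow> W \<subseteq> V \<Longrightarrow> swap \<S> G S W \<subseteq> V"
  by (auto simp: swap_def)

lemma swap_in_class: "induced G S \<in> \<S> \<Longrightarrow> induced G (swap \<S> G S W) \<in> \<S>"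
  by (simp add: swap_def)

lemma card_foldl_swap: "card S \<le> card (foldl (swap \<S> G) S Ws)"
  by (induction Ws arbitrary: S) (auto intro: card_swap le_trans)

lemma foldl_swap_subset:
  "S \<subseteq> V \<Longrightarrow> \<forall>W\<in>set Ws. W \<subseteq> V \<Longrightarrow> foldl (swap \<S> G) S Ws \<subseteq> V"
  by (induction Ws arbitrary: S) (simp_all add: swap_subset)

lemma foldl_swap_in_class: "induced G S \<in> \<S> \<Longrightarrow> induced G (foldl (swap \<S> G) S Ws) \<in> \<S>"
  by (induction Ws arbitrary: S) (simp_all add: swap_in_class)

text \<open>When \<open>W\<close> is reached, the current set may no longer be \<open>S\<close>. But
  then an earlier swap was accepted, so the size has grown already, and it never shrinks.\<close>

lemma foldl_swap_improves:
  assumes "W \<in> set Ws" "card S < card (sym_diff S W)" "induced G (sym_diff S W) \<in> \<S>"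
  shows "card S < card (foldl (swap \<S> G) S Ws)"
  using assms(1)
proof (induction Ws)
  case (Cons W' Ws)
  show ?case
  proof (cases "swap \<S> G S W' = S")
    case True
    with assms(2,3) have "W \<noteq> W'" by (auto simp: swap_def)
    with True Cons show ?thesis by simp
  next
    case False
    then have "card S < card (swap \<S> G S W')" by (auto simp: swap_def split: if_splits)
    also have "\<dots> \<le> card (foldl (swap \<S> G) S (W' # Ws))" by (simp add: card_foldl_swap)
    finally show ?thesis .
  qed
qed simp

definition search :: "ugraph set \<Rightarrow> ugraph \<Rightarrow> nat set list \<Rightarrow> nat \<Rightarrow> nat set" where
  "search \<S> G Ws n = foldl (\<lambda>S _. foldl (swap \<S> G) S Ws) {} [0..<n]"

text \<open>The lower bound \<open>min n (card S)\<close> records a gain of at least one vertex per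
  round while the size is below \<open>card S\<close>. The start is the empty set, which belongs to
  the class as a subset of \<open>S\<close>.\<close>

lemma search_props:
  assumes classes: "sparse_dense_classes c \<S> \<D>" and G: "simple_graph G"
    and part: "sparse_dense_partition \<S> \<D> G S D"
    and Ws: "\<forall>W\<in>set Ws. W \<subseteq> verts G"
      "\<And>W. W \<subseteq> verts G \<Longrightarrow> W \<noteq> {} \<Longrightarrow> card W \<le> 2 * c + 1 \<Longrightarrow> W \<in> set Ws"
  shows "search \<S> G Ws n \<subseteq> verts G \<and> induced G (search \<S> G Ws n) \<in> \<S> \<and>
    min n (card S) \<le> card (search \<S> G Ws n)"
proof (induction n)
  case 0
  have "induced G {} \<in> \<S>"
    using part hereditary_induced[OF sparse_dense_classesD(2)[OF classes], of G S "{}"]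
    by (auto simp: sparse_dense_partition_def)
  then show ?case by (simp add: search_def)
next
  case (Suc n)
  let ?S = "search \<S> G Ws n"
  have S: "?S \<subseteq> verts G" "induced G ?S \<in> \<S>" "min n (card S) \<le> card ?S"
    using Suc by auto
  have eq: "search \<S> G Ws (Suc n) = foldl (swap \<S> G) ?S Ws" by (simp add: search_def)
  have "min (Suc n) (card S) \<le> card (search \<S> G Ws (Suc n))"
  proof (cases "card ?S < card S")
    case True
    obtain W where W: "W \<subseteq> verts G" "W \<noteq> {}" "card W \<le> 2 * c + 1"
      "card ?S < card (sym_diff ?S W)" "induced G (sym_diff ?S W) \<in> \<S>"
      using exchange[OF classes G part S(1,2) True] by blast
    then have "card ?S < card (search \<S> G Ws (Suc n))"
      unfolding eq by (intro foldl_swap_improves[OF Ws(2)])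
    then show ?thesis using S(3) by simp
  next
    case False
    then show ?thesis unfolding eq using card_foldl_swap[of ?S \<S> G Ws] by simp
  qed
  moreover have "search \<S> G Ws (Suc n) \<subseteq> verts G"
    unfolding eq by (rule foldl_swap_subset[OF S(1) Ws(1)])
  moreover have "induced G (search \<S> G Ws (Suc n)) \<in> \<S>"
    unfolding eq by (rule foldl_swap_in_class[OF S(2)])
  ultimately show ?case by blast
qed

text \<open>Deleting \<open>nbrs G Y\<close> from \<open>Y\<close> makes the result independent in any case, so that no test is needed;
  if \<open>Y\<close> is independent already, nothing is deleted.\<close>

definition candidate :: "(nat \<Rightarrow> ugraph \<Rightarrow> nat set) \<Rightarrow> nat \<Rightarrow> ugraph \<Rightarrow> nat set \<Rightarrow> nat set \<Rightarrow> nat set" where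
  "candidate m n G S X =
     (let xs = members n (S - nbrs G X); Y = X \<union> (!) xs ` m (length xs) (compress G xs)
      in Y - nbrs G Y)"

lemma independent_set_nbrs: "independent_set G X \<longleftrightarrow> X \<subseteq> verts G \<and> X \<inter> nbrs G X = {}"
  by (auto simp: independent_set_def nbrs_def)

lemma nbrs_mono: "X \<subseteq> Y \<Longrightarrow> nbrs G X \<subseteq> nbrs G Y"
  by (auto simp: nbrs_def)

lemma independent_diff_nbrs: "Y \<subseteq> verts G \<Longrightarrow> independent_set G (Y - nbrs G Y)"
  unfolding independent_set_nbrs using nbrs_mono[of "Y - nbrs G Y" Y G] by blast

lemma independent_Un:
  assumes "independent_set G X" "independent_set G Y" "Y \<inter> nbrs G X = {}"
  shows "independent_set G (X \<union> Y)"
proof -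
  have "{v, u} \<notin> edges G" "{u, v} \<notin> edges G" if "u \<in> X" "v \<in> Y" for u v
    using assms(3) that by (auto simp: nbrs_def insert_commute[of u v])
  with assms(1,2) show ?thesis by (auto simp: independent_set_def)
qed

text \<open>If \<open>X\<close> lies in \<open>J\<close> and contains all of \<open>J\<close>
  outside \<open>S\<close>, then \<open>J \<inter> S\<close> avoids the neighbours of
  \<open>X\<close>, so it is no larger than the independent set found in
  \<open>S - nbrs G X\<close>. The first claim allows arbitrary \<open>X\<close>, since the
  enumeration also tries sets that are not independent.\<close>

lemma candidate_props:
  assumes \<S>: "graph_class \<S>" "hereditary \<S>" and G: "simple_graph G" "verts G = {..<n}"
    and S: "S \<subseteq> verts G" "induced G S \<in> \<S>"
    and m: "\<And>k H. H \<in> \<S> \<Longrightarrow> verts H = {..<k} \<Longrightarrow> maximum_independent_set H (m k H)"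
    and X: "X \<subseteq> verts G"
  shows "independent_set G (candidate m n G S X)"
    and "\<And>J. independent_set G J \<Longrightarrow> X \<subseteq> J \<Longrightarrow> J - S \<subseteq> X \<Longrightarrow> card J \<le> card (candidate m n G S X)"
proof -
  define B where "B = S - nbrs G X"
  define xs where "xs = members n B"
  define I where "I = m (length xs) (compress G xs)"
  define Y where "Y = X \<union> (!) xs ` I"
  have xs: "distinct xs" "set xs = verts G \<inter> B" by (auto simp: xs_def G(2))
  have "induced G B \<in> \<S>" using hereditary_induced[OF \<S>(2) S(2,1)] by (auto simp: B_def)
  then have "compress G xs \<in> \<S>" using compress_in_class[OF \<S>(1) G(1) xs] by simp
  then have max: "maximum_independent_set (compress G xs) I"
    unfolding I_def by (rule m) simp
  note I = maximum_independent_compress[OF xs max]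
  have cand: "candidate m n G S X = Y - nbrs G Y"
    by (simp add: candidate_def Let_def Y_def I_def xs_def B_def del: members_props)
  have "(!) xs ` I \<subseteq> verts G" using I(1) by (simp add: independent_set_def)
  then have Y: "Y \<subseteq> verts G" using X by (simp add: Y_def)
  then show "independent_set G (candidate m n G S X)"
    unfolding cand by (rule independent_diff_nbrs)
  fix J assume J: "independent_set G J" "X \<subseteq> J" "J - S \<subseteq> X"
  have fin: "finite (verts G)" by (simp add: G(2))
  have "J \<inter> nbrs G X = {}" using J(1,2) nbrs_mono unfolding independent_set_nbrs by blast
  then have JB: "J \<inter> S \<subseteq> B" by (auto simp: B_def)
  have sub: "independent_set G K" if "K \<subseteq> J" for K using J(1) that by (auto simp: independent_set_def)
  have "independent_set G Y" unfolding Y_def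
    by (rule independent_Un[OF sub[OF J(2)] I(1)]) (use I(2) in \<open>auto simp: B_def\<close>)
  then have candY: "candidate m n G S X = Y" unfolding cand independent_set_nbrs by blast
  have "card J \<le> card (J - S) + card (J \<inter> S)"
    using card_Un_le[of "J - S" "J \<inter> S"] by (simp add: Un_Diff_Int)
  also have "card (J \<inter> S) \<le> card ((!) xs ` I)" by (rule I(3)[OF sub JB]) simp
  also have "card (J - S) + card ((!) xs ` I) = card ((J - S) \<union> (!) xs ` I)"
    using I(2) J(1) fin finite_subset[OF _ fin] I(1)
    by (intro card_Un_disjoint[symmetric]) (auto simp: B_def independent_set_def)
  also have "\<dots> \<le> card Y"
    using J(3) Y finite_subset[OF Y fin] by (intro card_mono) (auto simp: Y_def)
  finally show "card J \<le> card (candidate m n G S X)" by (simp add: candY)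
qed

definition larger :: "nat set \<Rightarrow> nat set \<Rightarrow> nat set" where
  "larger X Y = (if card X < card Y then Y else X)"

lemma foldl_larger:
  "card X \<le> card (foldl (\<lambda>X w. larger X (g w)) X ws) \<and>
   (\<forall>w\<in>set ws. card (g w) \<le> card (foldl (\<lambda>X w. larger X (g w)) X ws)) \<and>
   foldl (\<lambda>X w. larger X (g w)) X ws \<in> insert X (g ` set ws)"
proof (induction ws arbitrary: X)
  case (Cons w ws)
  have "card X \<le> card (larger X (g w))" "card (g w) \<le> card (larger X (g w))" "larger X (g w) \<in> {X, g w}"
    by (auto simp: larger_def)
  with Cons[of "larger X (g w)"] show ?case by (auto intro: le_trans)
qed simp

definition best_candidate :: "(nat \<Rightarrow> ugraph \<Rightarrow> nat set) \<Rightarrow> nat \<Rightarrow> ugraph \<Rightarrow> nat set \<Rightarrow> nat set list \<Rightarrow> nat set" where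
  "best_candidate m n G S Ws = foldl (\<lambda>I X. larger I (candidate m n G S X)) {} Ws"

lemma best_candidate_maximum:
  assumes classes: "sparse_dense_classes c \<S> \<D>" and D: "\<D> \<subseteq> co_clique_free t" and "t > 0"
    and G: "simple_graph G" "verts G = {..<n}" and part: "sparse_dense_partition \<S> \<D> G S D"
    and S': "S' \<subseteq> verts G" "induced G S' \<in> \<S>" "card S \<le> card S'"
    and m: "\<And>k H. H \<in> \<S> \<Longrightarrow> verts H = {..<k} \<Longrightarrow> maximum_independent_set H (m k H)"
    and Ws: "\<forall>W\<in>set Ws. W \<subseteq> verts G"
      "\<And>W. W \<subseteq> verts G \<Longrightarrow> W \<noteq> {} \<Longrightarrow> card W \<le> c + t \<Longrightarrow> W \<in> set Ws"
  shows "maximum_independent_set G (best_candidate m n G S' Ws)"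
proof -
  have \<S>: "graph_class \<S>" "hereditary \<S>" by (rule sparse_dense_classesD[OF classes])+
  let ?R = "best_candidate m n G S' Ws"
  note best = foldl_larger[of "{}" "candidate m n G S'" Ws, folded best_candidate_def]
  have best_ge: "card (candidate m n G S' X) \<le> card ?R" if "X \<in> set Ws" for X
    using best[THEN conjunct2, THEN conjunct1] that by (rule bspec)
  have "?R \<in> insert {} (candidate m n G S' ` set Ws)" by (rule best[THEN conjunct2, THEN conjunct2])
  then have ind: "independent_set G ?R"
  proof
    assume "?R = {}"
    then show ?thesis by (simp add: independent_set_def)
  next
    assume "?R \<in> candidate m n G S' ` set Ws"
    then obtain X where "X \<in> set Ws" "?R = candidate m n G S' X" by (rule imageE)
    moreover from this have "independent_set G (candidate m n G S' X)"
      using Ws(1) by (intro candidate_props(1)[OF \<S> G S'(1,2) m]) auto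
    ultimately show ?thesis by simp
  qed
  have SD: "S \<union> D = verts G" "S \<inter> D = {}" "induced G S \<in> \<S>" "induced G D \<in> \<D>"
    using part by (auto simp: sparse_dense_partition_def)
  have fin: "finite X" if "X \<subseteq> verts G" for X using that G(2) finite_subset by auto
  have sub: "S \<subseteq> verts G" "D \<subseteq> verts G" using SD(1) by auto
  have "card J \<le> card ?R" if J: "independent_set G J" for J
  proof (cases "J = {}")
    case False
    have JV: "J \<subseteq> verts G" using J by (simp add: independent_set_def)
    \<comment> \<open>Otherwise \<open>t\<close> of these vertices would form an independent set in
      a graph of the dense class.\<close>
    have "card (J \<inter> D) < t"
    proof (rule ccontr)
      assume "\<not> card (J \<inter> D) < t"
      then obtain K where K: "K \<subseteq> J \<inter> D" "card K = t"
        by (meson not_less obtain_subset_with_card_n)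
      moreover have "{u, v} \<notin> edges G" if "u \<in> K" "v \<in> K" for u v
        using J K(1) that unfolding independent_set_def by blast
      ultimately have "independent_set (induced G D) K"
        using JV by (auto simp: independent_set_def)
      moreover have "induced G D \<in> co_clique_free t" using D SD(4) by (rule subsetD)
      ultimately show False using K(2) by (auto simp: co_clique_free_def)
    qed
    have "S' - S = S' \<inter> D" using SD(1,2) S'(1) by auto
    then have "card (S' - S) \<le> c"
      using sparse_dense_classesD(3)[OF classes G(1) S'(1) sub(2) S'(2) SD(4)] by simp
    \<comment> \<open>The common part counts equally in both sizes, so
      \<open>card S <= card S'\<close> carries over to the differences.\<close>
    moreover have "card (S - S') \<le> card (S' - S)"
      using S'(3) card_Int_Diff[OF fin[OF S'(1)], of S] card_Int_Diff[OF fin[OF sub(1)], of S']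
      by (simp add: Int_commute)
    ultimately have "card (S - S') \<le> c" by simp
    moreover have "card (J - S') \<le> card ((J \<inter> D) \<union> (S - S'))"
      using SD(1) sub JV by (intro card_mono fin) auto
    ultimately have small: "card (J - S') < c + t"
      using \<open>card (J \<inter> D) < t\<close> card_Un_le[of "J \<inter> D" "S - S'"] by linarith
    \<comment> \<open>The enumeration omits the empty set. If \<open>J\<close> lies inside
      \<open>S'\<close>, one vertex of \<open>J\<close> is used instead; \<open>t > 0\<close> makes
      room for it.\<close>
    obtain X where X: "X \<subseteq> J" "J - S' \<subseteq> X" "X \<noteq> {}" "card X \<le> c + t"
    proof (cases "J - S' = {}")
      case True
      obtain v where "v \<in> J" using False by blast
      with True \<open>t > 0\<close> show ?thesis by (intro that[of "{v}"]) auto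
    next
      case False
      with small show ?thesis by (intro that[of "J - S'"]) auto
    qed
    have XV: "X \<subseteq> verts G" using X(1) JV by (rule order_trans)
    have "card J \<le> card (candidate m n G S' X)" 
      by (rule candidate_props(2)[OF \<S> G S'(1,2) _ XV J X(1,2)]) (rule m)
    also have "\<dots> \<le> card ?R" by (rule best_ge[OF Ws(2)[OF XV X(3,4)]])
    finally show ?thesis .
  qed simp
  with ind show ?thesis by (simp add: maximum_independent_set_def)
qed

section \<open>Running time of the algorithm\<close>

lemma computes_apply:
  assumes "computes B g h U" "computes A f (\<lambda>i. g (\<phi> i)) T"
    and "\<And>i. i \<in> A \<Longrightarrow> \<phi> i \<in> B" "\<And>i. i \<in> A \<Longrightarrow> U (\<phi> i) \<le> C * T i"
  shows "computes A f (\<lambda>i. h (\<phi> i)) T"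
  by (rule computes_trans[OF assms(2)], rule computes_mono[OF computes_reindex[OF assms(1,3)] assms(4)])

lemma computes_empty_set:
  assumes "computes A f (\<lambda>i. enc_graph (n i) (G i)) T" and n: "\<And>i. i \<in> A \<Longrightarrow> n i \<le> C * T i"
  shows "computes A f (\<lambda>i. enc_set (n i) {}) T"
proof -
  have "computes A f (\<lambda>i. enc_list (map (\<lambda>v. Nil_tree) [0..<n i])) T"
  proof (rule computes_map[where U = "\<lambda>_. 1" and C = C])
    show "computes A f (\<lambda>i. enc_list (map (row (n i) (G i)) [0..<n i])) T"
      using assms(1) by (simp add: enc_graph_rows)
  qed (use n in \<open>auto intro!: computes_const\<close>)
  then show ?thesis by (simp add: enc_set_def enc_bool_def)
qed

text \<open>Both conditions are evaluated before branching. This is safe because recognition halts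
  on every simple graph. The renumbered subgraph has at most \<open>n i\<close> vertices, so by
  monotonicity \<open>T1 (n i)\<close> bounds the call.\<close>

lemma computes_swap:
  assumes rec: "recognizable_in_time \<S> T1" "mono T1" and \<S>: "graph_class \<S>"
    and G: "\<And>i. i \<in> A \<Longrightarrow> simple_graph (G i)" "\<And>i. i \<in> A \<Longrightarrow> verts (G i) = {..<n i}"
    and sub: "\<And>i. i \<in> A \<Longrightarrow> S i \<subseteq> {..<n i}" "\<And>i. i \<in> A \<Longrightarrow> W i \<subseteq> {..<n i}"
    and comp: "computes A f (\<lambda>i. enc_graph (n i) (G i)) T"
      "computes A f (\<lambda>i. enc_set (n i) (S i)) T" "computes A f (\<lambda>i. enc_set (n i) (W i)) T"
    and time: "\<And>i. i \<in> A \<Longrightarrow> T1 (n i) \<le> T i" "\<And>i. i \<in> A \<Longrightarrow> Suc (n i) * Suc (n i) \<le> T i"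
  shows "computes A f (\<lambda>i. enc_set (n i) (swap \<S> (G i) (S i) (W i))) T"
proof -
  let ?X = "\<lambda>i. sym_diff (S i) (W i)"
  let ?H = "\<lambda>i. compress (G i) (members (n i) (?X i))"
  have n: "n i \<le> 1 * T i" if "i \<in> A" for i using time(2)[OF that] by simp
  have X: "computes A f (\<lambda>i. enc_set (n i) (?X i)) T"
    by (rule computes_cong[OF computes_set_op[OF comp(2,3) n, where op = "(\<noteq>)"]])
      (assumption, rule arg_cong[where f = "enc_set _"], auto)
  have Xsub: "?X i \<subseteq> {..<n i}" if "i \<in> A" for i
    using sub[OF that] by auto
  obtain p where p: "\<forall>k H. simple_graph H \<and> verts H = {..<k} \<longrightarrow>
      (\<exists>l. runs p (enc_graph k H) (enc_bool (H \<in> \<S>)) l \<and> l \<le> T1 k)"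
    using rec(1) unfolding recognizable_in_time_def by (rule exE)
  have recog: "computes {(k, H). simple_graph H \<and> verts H = {..<k}}
      (\<lambda>p. enc_graph (fst p) (snd p)) (\<lambda>p. enc_bool (snd p \<in> \<S>)) (\<lambda>p. T1 (fst p))"
  proof (rule runs_computes[where p = p])
    fix q assume "q \<in> {(k, H). simple_graph H \<and> verts H = {..<k}}"
    then have q: "simple_graph (snd q) \<and> verts (snd q) = {..<fst q}"
      by (simp add: split_beta)
    obtain l where "runs p (enc_graph (fst q) (snd q)) (enc_bool (snd q \<in> \<S>)) l" "l \<le> T1 (fst q)"
      using p[THEN spec, THEN spec, THEN mp, OF q] by (elim exE conjE)
    then show "\<exists>l\<le>T1 (fst q). runs p (enc_graph (fst q) (snd q)) (enc_bool (snd q \<in> \<S>)) l"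
      by (intro exI conjI)
  qed
  have H: "computes A f (\<lambda>i. enc_graph (card (?X i \<inter> {..<n i})) (?H i)) T"
    by (rule computes_compress[OF comp(1) X, where C = 1]) (use time(2) in simp)
  have "computes A f (\<lambda>i. enc_bool (snd (card (?X i \<inter> {..<n i}), ?H i) \<in> \<S>)) T"
  proof (rule computes_apply[OF recog, where C = 1])
    fix i assume i: "i \<in> A"
    show "(card (?X i \<inter> {..<n i}), ?H i) \<in> {(k, H). simple_graph H \<and> verts H = {..<k}}"
      using simple_compress[OF G(1)[OF i]] by simp
    have "card (?X i \<inter> {..<n i}) \<le> n i" using card_mono[of "{..<n i}" "?X i \<inter> {..<n i}"] by simp
    then have "T1 (card (?X i \<inter> {..<n i})) \<le> T1 (n i)" using rec(2) by (rule monoD[rotated])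
    then show "T1 (fst (card (?X i \<inter> {..<n i}), ?H i)) \<le> 1 * T i" using time(1)[OF i] by simp
  qed (use H in simp)
  then have ind: "computes A f (\<lambda>i. enc_bool (induced (G i) (?X i) \<in> \<S>)) T"
  proof (rule computes_cong)
    fix i assume i: "i \<in> A"
    have "?H i \<in> \<S> \<longleftrightarrow> induced (G i) (?X i) \<in> \<S>"
      by (rule compress_in_class[OF \<S> G(1)[OF i]]) (auto simp: G(2)[OF i])
    then show "enc_bool (snd (card (?X i \<inter> {..<n i}), ?H i) \<in> \<S>) = enc_bool (induced (G i) (?X i) \<in> \<S>)"
      by simp
  qed
  have "computes A f (\<lambda>i. enc_bool (card (S i) < card (?X i))) T"
    by (rule computes_card_less[OF comp(2) X n sub(1) Xsub])
  from computes_bool_op[OF this ind, of "(\<and>)"]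
 have "computes A f (\<lambda>i. if card (S i) < card (?X i) \<and> induced (G i) (?X i) \<in> \<S>
      then enc_set (n i) (?X i) else enc_set (n i) (S i)) T"
    by (rule computes_if_bool) (rule computes_subset[OF X] computes_subset[OF comp(2)], blast)+
  then show ?thesis by (rule computes_cong) (simp add: swap_def)
qed

text \<open>The rows of the matrix serve as a counter for the \<open>n i\<close> rounds. The factors
  \<open>Suc (n i)\<close> and \<open>Suc (length (Ws i))\<close> keep the bounds positive for empty
  lists, where a program still takes time.\<close>

lemma computes_search:
  assumes rec: "recognizable_in_time \<S> T1" "mono T1" and \<S>: "graph_class \<S>"
    and G: "\<And>i. i \<in> A \<Longrightarrow> simple_graph (G i)" "\<And>i. i \<in> A \<Longrightarrow> verts (G i) = {..<n i}"
    and Ws: "\<And>i W. i \<in> A \<Longrightarrow> W \<in> set (Ws i) \<Longrightarrow> W \<subseteq> {..<n i}"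
    and U: "\<And>i. i \<in> A \<Longrightarrow> T1 (n i) \<le> U i" "\<And>i. i \<in> A \<Longrightarrow> Suc (n i) * Suc (n i) \<le> U i"
    and T: "\<And>i. i \<in> A \<Longrightarrow> Suc (n i) * (Suc (length (Ws i)) * U i) \<le> C * T i"
  shows "computes A (\<lambda>i. Dot (enc_list (map (enc_set (n i)) (Ws i))) (enc_graph (n i) (G i)))
    (\<lambda>i. enc_set (n i) (search \<S> (G i) (Ws i) (n i))) T"
proof -
  let ?f = "\<lambda>i. Dot (enc_list (map (enc_set (n i)) (Ws i))) (enc_graph (n i) (G i))"
  let ?V = "\<lambda>i. Suc (length (Ws i)) * U i"
  let ?P = "\<lambda>i S. S \<subseteq> {..<n i}"
  have Upos: "0 < U i" if "i \<in> A" for i using U(2)[OF that] by simp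
  then have Vpos: "0 < ?V i" if "i \<in> A" for i using that by simp
  have TV: "Suc (n i) * ?V i \<le> C * T i" "0 < T i" if "i \<in> A" for i
    using T[OF that] Vpos[OF that] by (auto intro: gr0I)
  have nT: "n i \<le> C * T i" if "i \<in> A" for i
  proof -
    have "n i * 1 \<le> Suc (n i) * ?V i" using Vpos[OF that] by (intro mult_le_mono) auto
    then show ?thesis using TV(1)[OF that] by simp
  qed
  have graph: "computes A ?f (\<lambda>i. enc_graph (n i) (G i)) T"
    by (rule computes_snd, rule computes_id) (rule TV(2))
  show ?thesis
    unfolding search_def
  proof (rule computes_foldl[where st = "\<lambda>i. enc_set (n i)" and el = "\<lambda>i. row (n i) (G i)"
        and P = ?P and U = ?V and C = C and a = "\<lambda>_. {}"])
    show "computes A ?f (\<lambda>i. enc_set (n i) {}) T"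
      by (rule computes_empty_set[OF graph nT])
    show "computes A ?f (\<lambda>i. enc_list (map (row (n i) (G i)) [0..<n i])) T"
      using graph by (simp add: enc_graph_rows)
    let ?B = "{(i, S, v). i \<in> A \<and> ?P i S \<and> v \<in> set [0..<n i]}"
    let ?g = "\<lambda>p. Dot (enc_set (n (fst p)) (fst (snd p)))
      (Dot (row (n (fst p)) (G (fst p)) (snd (snd p))) (?f (fst p)))"
    have BV: "0 < ?V (fst p)" if "p \<in> ?B" for p
      using that by (intro Vpos) (simp add: split_beta)
    show "computes ?B ?g (\<lambda>p. enc_set (n (fst p)) (foldl (swap \<S> (G (fst p))) (fst (snd p)) (Ws (fst p))))
      (\<lambda>p. ?V (fst p))"
    proof (rule computes_foldl[where st = "\<lambda>p. enc_set (n (fst p))" and el = "\<lambda>p. enc_set (n (fst p))"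
        and P = "\<lambda>p. ?P (fst p)" and U = "\<lambda>p. U (fst p)" and C = 1])
      show "computes ?B ?g (\<lambda>p. enc_set (n (fst p)) (fst (snd p))) (\<lambda>p. ?V (fst p))"
        by (rule computes_head) (rule BV)
      show "computes ?B ?g (\<lambda>p. enc_list (map (enc_set (n (fst p))) (Ws (fst p)))) (\<lambda>p. ?V (fst p))"
        by (rule computes_weaken, rule computes_weaken, rule computes_head) (rule BV)
      let ?B' = "{(p, S, W). p \<in> ?B \<and> ?P (fst p) S \<and> W \<in> set (Ws (fst p))}"
      let ?g' = "\<lambda>q. Dot (enc_set (n (fst (fst q))) (fst (snd q)))
        (Dot (enc_set (n (fst (fst q))) (snd (snd q))) (?g (fst q)))"
      have B': "fst (fst q) \<in> A" "fst (snd q) \<subseteq> {..<n (fst (fst q))}"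
        "snd (snd q) \<in> set (Ws (fst (fst q)))" if "q \<in> ?B'" for q
        using that by (simp_all add: split_beta)
      have pos: "0 < U (fst (fst q))" if "q \<in> ?B'" for q using Upos B'(1)[OF that] by blast
      show "computes ?B' ?g' (\<lambda>q. enc_set (n (fst (fst q)))
          (swap \<S> (G (fst (fst q))) (fst (snd q)) (snd (snd q)))) (\<lambda>q. U (fst (fst q)))"
      proof (rule computes_swap[OF rec \<S>])
        show "computes ?B' ?g' (\<lambda>q. enc_graph (n (fst (fst q))) (G (fst (fst q)))) (\<lambda>q. U (fst (fst q)))"
          by (rule computes_weaken, rule computes_weaken, rule computes_weaken, rule computes_weaken,
            rule computes_snd, rule computes_id) (rule pos)
        show "computes ?B' ?g' (\<lambda>q. enc_set (n (fst (fst q))) (fst (snd q))) (\<lambda>q. U (fst (fst q)))"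
          by (rule computes_head) (rule pos)
        show "computes ?B' ?g' (\<lambda>q. enc_set (n (fst (fst q))) (snd (snd q))) (\<lambda>q. U (fst (fst q)))"
          by (rule computes_weaken, rule computes_head) (rule pos)
      next
        fix q assume q: "q \<in> ?B'"
        show "simple_graph (G (fst (fst q)))" "verts (G (fst (fst q))) = {..<n (fst (fst q))}"
          by (rule G[OF B'(1)[OF q]])+
        show "fst (snd q) \<subseteq> {..<n (fst (fst q))}" by (rule B'(2)[OF q])
        show "snd (snd q) \<subseteq> {..<n (fst (fst q))}" by (rule Ws[OF B'(1,3)[OF q]])
        show "T1 (n (fst (fst q))) \<le> U (fst (fst q))" by (rule U(1)[OF B'(1)[OF q]])
        show "Suc (n (fst (fst q))) * Suc (n (fst (fst q))) \<le> U (fst (fst q))"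
          by (rule U(2)[OF B'(1)[OF q]])
      qed
    next
      fix p S W assume p: "p \<in> ?B" "?P (fst p) S" "W \<in> set (Ws (fst p))"
      then have "fst p \<in> A" by (simp add: split_beta)
      then show "?P (fst p) (swap \<S> (G (fst p)) S W)"
        using swap_subset[OF p(2) Ws[OF _ p(3)]] by blast
    qed auto
  next
    fix i S and v :: nat assume "i \<in> A" "?P i S"
    then show "?P i (foldl (swap \<S> (G i)) S (Ws i))"
      by (intro foldl_swap_subset ballI) (assumption, rule Ws)
  next
    fix i assume "i \<in> A"
    then show "length [0..<n i] * ?V i \<le> C * T i"
      using TV(1)[of i] by simp
  qed simp
qed

lemma computes_candidate:
  assumes \<S>: "graph_class \<S>" "hereditary \<S>"
    and mis: "computes {(k, H). H \<in> \<S> \<and> verts H = {..<k}} (\<lambda>p. enc_graph (fst p) (snd p))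
      (\<lambda>p. enc_set (fst p) (m (fst p) (snd p))) (\<lambda>p. T2 (fst p))" "mono T2"
    and m: "\<And>k H. H \<in> \<S> \<Longrightarrow> verts H = {..<k} \<Longrightarrow> maximum_independent_set H (m k H)"
    and G: "\<And>i. i \<in> A \<Longrightarrow> simple_graph (G i)" "\<And>i. i \<in> A \<Longrightarrow> verts (G i) = {..<n i}"
    and S: "\<And>i. i \<in> A \<Longrightarrow> S i \<subseteq> {..<n i}" "\<And>i. i \<in> A \<Longrightarrow> induced (G i) (S i) \<in> \<S>"
    and X: "\<And>i. i \<in> A \<Longrightarrow> X i \<subseteq> {..<n i}"
    and comp: "computes A f (\<lambda>i. enc_graph (n i) (G i)) T"
      "computes A f (\<lambda>i. enc_set (n i) (S i)) T" "computes A f (\<lambda>i. enc_set (n i) (X i)) T"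
    and time: "\<And>i. i \<in> A \<Longrightarrow> T2 (n i) \<le> T i" "\<And>i. i \<in> A \<Longrightarrow> Suc (n i) * Suc (n i) \<le> T i"
  shows "computes A f (\<lambda>i. enc_set (n i) (candidate m (n i) (G i) (S i) (X i))) T"
proof -
  let ?B = "\<lambda>i. S i - nbrs (G i) (X i)"
  let ?xs = "\<lambda>i. members (n i) (?B i)"
  let ?H = "\<lambda>i. compress (G i) (?xs i)"
  let ?Y = "\<lambda>i. X i \<union> (!) (?xs i) ` m (length (?xs i)) (?H i)"
  have n: "n i \<le> 1 * T i" "n i * n i \<le> 1 * T i" if "i \<in> A" for i using time(2)[OF that] by auto
  have "computes A f (\<lambda>i. enc_set (n i) {v. v \<in> S i \<and> v \<notin> nbrs (G i) (X i)}) T"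
    by (rule computes_set_op[OF comp(2) computes_nbrs[OF comp(1,3) n(2) X] n(1),
        where op = "\<lambda>a b. a \<and> \<not> b"])
  then have B: "computes A f (\<lambda>i. enc_set (n i) (?B i)) T"
    by (simp add: set_diff_eq)
  have H: "computes A f (\<lambda>i. enc_graph (length (?xs i)) (?H i)) T"
    using computes_compress[OF comp(1) B, where C = 1] time(2) by simp
  \<comment> \<open>This meets the promise under which the program for independent sets is known to
    halt.\<close>
  have H\<S>: "?H i \<in> \<S>" if i: "i \<in> A" for i
  proof -
    have "induced (G i) (?B i) \<in> \<S>"
      by (rule hereditary_induced[OF \<S>(2) S(2)[OF i]]) (use S(1) G(2) i in auto)
    moreover have "?H i \<in> \<S> \<longleftrightarrow> induced (G i) (?B i) \<in> \<S>"
      by (rule compress_in_class[OF \<S>(1) G(1)[OF i]]) (auto simp: G(2)[OF i])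
    ultimately show ?thesis by simp
  qed
  have "computes A f (\<lambda>i. enc_set (fst (length (?xs i), ?H i))
      (m (fst (length (?xs i), ?H i)) (snd (length (?xs i), ?H i)))) T"
  proof (rule computes_apply[OF mis(1), where C = 1])
    fix i assume i: "i \<in> A"
    show "(length (?xs i), ?H i) \<in> {(k, H). H \<in> \<S> \<and> verts H = {..<k}}"
      using H\<S>[OF i] by simp
    have "length (?xs i) \<le> n i" unfolding members_def by (rule order_trans[OF length_filter_le]) simp
    then have "T2 (length (?xs i)) \<le> T2 (n i)" using mis(2) by (rule monoD[rotated])
    then show "T2 (fst (length (?xs i), ?H i)) \<le> 1 * T i" using time(1)[OF i] by simp
  qed (use H in simp)
  then have J: "computes A f (\<lambda>i. enc_set (length (?xs i)) (m (length (?xs i)) (?H i))) T"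
    by simp
  have "computes A f (\<lambda>i. enc_set (n i) ((!) (?xs i) ` m (length (?xs i)) (?H i))) T"
  proof (rule computes_expand[OF B J n(1)])
    fix i assume i: "i \<in> A"
    show "m (length (?xs i)) (?H i) \<subseteq> {..<length (?xs i)}"
      using m[OF H\<S>[OF i], of "length (?xs i)"]
      by (simp add: maximum_independent_set_def independent_set_def)
  qed
  then have "computes A f (\<lambda>i. enc_set (n i) {v. v \<in> X i \<or> v \<in> (!) (?xs i) ` m (length (?xs i)) (?H i)}) T"
    by (rule computes_set_op[OF comp(3)]) (rule n(1))
  then have Y: "computes A f (\<lambda>i. enc_set (n i) (?Y i)) T"
    by (simp add: Un_def)
  have Ysub: "?Y i \<subseteq> {..<n i}" if i: "i \<in> A" for i
  proof -
    have "?xs i ! a \<in> {..<n i}" if "a \<in> m (length (?xs i)) (?H i)" for a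
    proof -
      have "a < length (?xs i)"
        using m[OF H\<S>[OF i], of "length (?xs i)"] that
        by (auto simp: maximum_independent_set_def independent_set_def)
      from nth_mem[OF this] show ?thesis by simp
    qed
    then show ?thesis using X[OF i] by auto
  qed
  have "computes A f (\<lambda>i. enc_set (n i) {v. v \<in> ?Y i \<and> v \<notin> nbrs (G i) (?Y i)}) T"
    by (rule computes_set_op[OF Y computes_nbrs[OF comp(1) Y n(2) Ysub] n(1),
        where op = "\<lambda>a b. a \<and> \<not> b"])
  then show ?thesis
    by (rule computes_cong) (simp add: candidate_def Let_def set_diff_eq)
qed

lemma computes_best_candidate:
  assumes \<S>: "graph_class \<S>" "hereditary \<S>"
    and mis: "computes {(k, H). H \<in> \<S> \<and> verts H = {..<k}} (\<lambda>p. enc_graph (fst p) (snd p))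
      (\<lambda>p. enc_set (fst p) (m (fst p) (snd p))) (\<lambda>p. T2 (fst p))" "mono T2"
    and m: "\<And>k H. H \<in> \<S> \<Longrightarrow> verts H = {..<k} \<Longrightarrow> maximum_independent_set H (m k H)"
    and G: "\<And>i. i \<in> A \<Longrightarrow> simple_graph (G i)" "\<And>i. i \<in> A \<Longrightarrow> verts (G i) = {..<n i}"
    and S: "\<And>i. i \<in> A \<Longrightarrow> S i \<subseteq> {..<n i}" "\<And>i. i \<in> A \<Longrightarrow> induced (G i) (S i) \<in> \<S>"
    and Ws: "\<And>i W. i \<in> A \<Longrightarrow> W \<in> set (Ws i) \<Longrightarrow> W \<subseteq> {..<n i}"
    and U: "\<And>i. i \<in> A \<Longrightarrow> T2 (n i) \<le> U i" "\<And>i. i \<in> A \<Longrightarrow> Suc (n i) * Suc (n i) \<le> U i"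
    and T: "\<And>i. i \<in> A \<Longrightarrow> Suc (length (Ws i)) * U i \<le> C * T i"
  shows "computes A (\<lambda>i. Dot (enc_set (n i) (S i))
      (Dot (enc_list (map (enc_set (n i)) (Ws i))) (enc_graph (n i) (G i))))
    (\<lambda>i. enc_set (n i) (best_candidate m (n i) (G i) (S i) (Ws i))) T"
proof -
  let ?f = "\<lambda>i. Dot (enc_set (n i) (S i))
    (Dot (enc_list (map (enc_set (n i)) (Ws i))) (enc_graph (n i) (G i)))"
  let ?P = "\<lambda>i S. S \<subseteq> {..<n i}"
  let ?c = "\<lambda>i. candidate m (n i) (G i) (S i)"
  have Upos: "0 < U i" if "i \<in> A" for i using U(2)[OF that] by simp
  have Tpos: "0 < T i" if "i \<in> A" for i
    using T[OF that] Upos[OF that] by (auto intro: gr0I)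
  have UT: "U i \<le> C * T i" if "i \<in> A" for i using T[OF that] by simp
  have nT: "n i \<le> C * T i" if "i \<in> A" for i
    using U(2)[OF that] UT[OF that] by simp
  \<comment> \<open>Comparing sizes of encoded sets is faithful only below \<open>n i\<close>, so
    the loop invariant needs every candidate to stay there.\<close>
  have cand: "?P i (?c i X)" if "i \<in> A" "X \<subseteq> {..<n i}" for i X
  proof -
    have "independent_set (G i) (?c i X)"
    proof (rule candidate_props(1)[OF \<S> G[OF that(1)] _ S(2)[OF that(1)]])
      show "S i \<subseteq> verts (G i)" "X \<subseteq> verts (G i)"
        using S(1)[OF that(1)] that(2) by (simp_all add: G(2)[OF that(1)])
    qed (rule m)
    then show ?thesis by (simp add: independent_set_def G(2)[OF that(1)])
  qed
  have graph: "computes A ?f (\<lambda>i. enc_graph (n i) (G i)) T"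
    by (rule computes_snd, rule computes_snd, rule computes_id) (rule Tpos)
  show ?thesis
    unfolding best_candidate_def
  proof (rule computes_foldl[where st = "\<lambda>i. enc_set (n i)" and el = "\<lambda>i. enc_set (n i)"
        and P = ?P and U = U and C = C and a = "\<lambda>_. {}"])
    show "computes A ?f (\<lambda>i. enc_set (n i) {}) T"
      by (rule computes_empty_set[OF graph nT])
    show "computes A ?f (\<lambda>i. enc_list (map (enc_set (n i)) (Ws i))) T"
      by (rule computes_weaken, rule computes_head) (rule Tpos)
    let ?B = "{(i, I, X). i \<in> A \<and> ?P i I \<and> X \<in> set (Ws i)}"
    let ?g = "\<lambda>p. Dot (enc_set (n (fst p)) (fst (snd p)))
      (Dot (enc_set (n (fst p)) (snd (snd p))) (?f (fst p)))"
    let ?U = "\<lambda>p. U (fst p)"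
    have B: "fst p \<in> A" "snd (snd p) \<subseteq> {..<n (fst p)}" "fst (snd p) \<subseteq> {..<n (fst p)}"
      if "p \<in> ?B" for p
    proof -
      have p: "fst p \<in> A" "fst (snd p) \<subseteq> {..<n (fst p)}" "snd (snd p) \<in> set (Ws (fst p))"
        using that by (simp_all add: split_beta)
      then show "fst p \<in> A" "snd (snd p) \<subseteq> {..<n (fst p)}" "fst (snd p) \<subseteq> {..<n (fst p)}"
        using Ws by blast+
    qed
    have pos: "0 < U (fst p)" if "p \<in> ?B" for p using Upos B(1)[OF that] by blast
    have nU: "n (fst p) \<le> 1 * U (fst p)" if "p \<in> ?B" for p
      using U(2)[OF B(1)[OF that]] by simp
    have I: "computes ?B ?g (\<lambda>p. enc_set (n (fst p)) (fst (snd p))) ?U"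
      by (rule computes_head) (rule pos)
    have c: "computes ?B ?g (\<lambda>p. enc_set (n (fst p)) (?c (fst p) (snd (snd p)))) ?U"
    proof (rule computes_candidate[OF \<S> mis m])
      show "computes ?B ?g (\<lambda>p. enc_graph (n (fst p)) (G (fst p))) ?U"
        by (rule computes_weaken, rule computes_weaken, rule computes_weaken, rule computes_snd, rule computes_id)
          (rule pos)
      show "computes ?B ?g (\<lambda>p. enc_set (n (fst p)) (S (fst p))) ?U"
        by (rule computes_weaken, rule computes_weaken, rule computes_head) (rule pos)
      show "computes ?B ?g (\<lambda>p. enc_set (n (fst p)) (snd (snd p))) ?U"
        by (rule computes_weaken, rule computes_head) (rule pos)
    next
      fix p assume p: "p \<in> ?B"
      show "simple_graph (G (fst p))" "verts (G (fst p)) = {..<n (fst p)}"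
        by (rule G[OF B(1)[OF p]])+
      show "S (fst p) \<subseteq> {..<n (fst p)}" "induced (G (fst p)) (S (fst p)) \<in> \<S>"
        by (rule S[OF B(1)[OF p]])+
      show "snd (snd p) \<subseteq> {..<n (fst p)}" by (rule B(2)[OF p])
      show "T2 (n (fst p)) \<le> U (fst p)" by (rule U(1)[OF B(1)[OF p]])
      show "Suc (n (fst p)) * Suc (n (fst p)) \<le> U (fst p)"
        by (rule U(2)[OF B(1)[OF p]])
    qed
    have "computes ?B ?g (\<lambda>p. enc_bool (card (fst (snd p)) < card (?c (fst p) (snd (snd p))))) ?U"
      by (rule computes_card_less[OF I c nU]) (assumption, erule B(3), rule cand[OF B(1,2)])
    then have "computes ?B ?g (\<lambda>p. if card (fst (snd p)) < card (?c (fst p) (snd (snd p)))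
        then enc_set (n (fst p)) (?c (fst p) (snd (snd p))) else enc_set (n (fst p)) (fst (snd p))) ?U"
      by (rule computes_if_bool) (rule computes_subset[OF c] computes_subset[OF I], blast)+
    then show "computes ?B ?g (\<lambda>p. enc_set (n (fst p)) (larger (fst (snd p)) (?c (fst p) (snd (snd p))))) ?U"
      by (rule computes_cong) (simp add: larger_def)
  next
    fix i I X assume "i \<in> A" "?P i I" "X \<in> set (Ws i)"
    then show "?P i (larger I (?c i X))"
      using cand[of i X] Ws by (simp add: larger_def)
  next
    fix i assume "i \<in> A"
    then show "length (Ws i) * U i \<le> C * T i" using T[of i] by simp
  qed simp
qed

section \<open>Total running time and the exponent\<close>

lemma recognition_time_pos:
  assumes "recognizable_in_time \<S> T1"
  shows "T1 n > 0"
proof -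
  \<comment> \<open>An edgeless graph is a legal input for every \<open>n\<close>. For
    \<open>T2\<close> no such conclusion is available when the class has no graph on
    \<open>n\<close> vertices.\<close>
  have "simple_graph (Graph {..<n} {})" "verts (Graph {..<n} {}) = {..<n}"
    by (auto simp: simple_graph_def)
  then obtain p x y k where "runs p x y k" "k \<le> T1 n"
    using assms unfolding recognizable_in_time_def by blast
  then show ?thesis unfolding runs_def using exec_pos by fastforce
qed

text \<open>The exponent is \<open>M + 3\<close> with \<open>M = 2 * c + t + 1\<close>: a factor
  \<open>Suc n\<close> for the rounds, \<open>Suc n ^ M\<close> for the sets in each round, and
  \<open>Suc n ^ 2\<close>, next to \<open>T1 n + T2 n\<close>, for one set.\<close>

lemma sparse_dense_mis_computable:
  assumes classes: "sparse_dense_classes c \<S> \<D>" and D: "\<D> \<subseteq> co_clique_free t" and "t > 0"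
    and T1: "recognizable_in_time \<S> T1" "mono T1"
    and T2: "mis_computable_in_time \<S> T2" "mono T2"
  shows "\<exists>K. mis_computable_in_time (sparse_dense_graphs \<S> \<D>)
    (\<lambda>n. K * ((T1 n + T2 n) * Suc n ^ (2 * c + t + 4)))"
proof -
  \<comment> \<open>One list of sets serves both phases, which need sizes up to
    \<open>2 * c + 1\<close> and up to \<open>c + t\<close>.\<close>
  define M where "M = 2 * c + t + 1"
  define A where "A = {G \<in> sparse_dense_graphs \<S> \<D>. \<exists>n. verts G = {..<n}}"
  define n where "n G = card (verts G)" for G
  define Ws where "Ws G = small_sets (n G) M" for G
  define U where "U G = (T1 (n G) + T2 (n G)) * (Suc (n G) * Suc (n G))" for G
  define T where "T G = (T1 (n G) + T2 (n G)) * Suc (n G) ^ (M + 3)" for G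
  have G: "simple_graph G" "verts G = {..<n G}" if "G \<in> A" for G
  proof -
    from that obtain k where "simple_graph G" and k: "verts G = {..<k}"
      unfolding A_def sparse_dense_graphs_def by blast
    then show "simple_graph G" by simp
    show "verts G = {..<n G}" by (simp add: n_def k)
  qed
  have \<S>: "graph_class \<S>" "hereditary \<S>" by (rule sparse_dense_classesD[OF classes])+
  have pos: "T1 k > 0" for k by (rule recognition_time_pos[OF T1(1)])
  have U: "T1 (n G) \<le> U G" "T2 (n G) \<le> U G" "Suc (n G) * Suc (n G) \<le> U G" for G
  proof -
    have "(T1 (n G) + T2 (n G)) * 1 \<le> U G" unfolding U_def by (rule mult_le_mono2) simp
    then show "T1 (n G) \<le> U G" "T2 (n G) \<le> U G" by auto
    have "1 * (Suc (n G) * Suc (n G)) \<le> U G"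
      unfolding U_def using pos[of "n G"] by (intro mult_le_mono1) simp
    then show "Suc (n G) * Suc (n G) \<le> U G" by simp
  qed
  have len: "Suc (length (Ws G)) \<le> 2 * Suc (n G) ^ M" for G
  proof -
    have "length (Ws G) \<le> Suc (n G) ^ M" "1 \<le> Suc (n G) ^ M"
      unfolding Ws_def length_small_sets by (auto intro: power_mono)
    then show ?thesis by linarith
  qed
  have TU: "Suc (n G) * (Suc (length (Ws G)) * U G) \<le> 2 * T G" for G
  proof -
    have "Suc (n G) * (Suc (length (Ws G)) * U G) \<le> Suc (n G) * (2 * Suc (n G) ^ M * U G)"
      using len by (intro mult_le_mono) auto
    also have "\<dots> = 2 * T G"
      by (simp only: U_def T_def power_add power3_eq_cube mult_ac)
    finally show ?thesis .
  qed
  have UT: "Suc (length (Ws G)) * U G \<le> 2 * T G" for G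
    using TU[of G] by simp
  have Tpow: "Suc (n G) ^ k \<le> 1 * T G" if "k \<le> M + 3" for k G
  proof -
    have "Suc (n G) ^ k \<le> Suc (n G) ^ (M + 3)" using that by (intro power_increasing) auto
    also have "\<dots> \<le> T G" unfolding T_def using pos[of "n G"] by simp
    finally show ?thesis by simp
  qed
  have nT: "Suc (n G) * Suc (n G) \<le> 1 * T G" "0 < T G" for G
    using Tpow[of 2 G] Tpow[of 0 G] by (auto simp: power2_eq_square)
  obtain p where p: "\<forall>k H. H \<in> \<S> \<and> verts H = {..<k} \<longrightarrow>
      (\<exists>I l. maximum_independent_set H I \<and> runs p (enc_graph k H) (enc_set k I) l \<and> l \<le> T2 k)"
    using T2(1) unfolding mis_computable_in_time_def by (rule exE)
  \<comment> \<open>\<open>computes\<close> speaks of functions, whereas the specification asserts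
    that some maximum independent set is returned. So for each graph one set that fits the output of
    \<open>p\<close> is fixed.\<close>
  define m where "m k H = (SOME I. maximum_independent_set H I \<and>
      (\<exists>l\<le>T2 k. runs p (enc_graph k H) (enc_set k I) l))" for k H
  have m: "maximum_independent_set H (m k H)" "\<exists>l\<le>T2 k. runs p (enc_graph k H) (enc_set k (m k H)) l"
    if "H \<in> \<S>" "verts H = {..<k}" for k H
  proof -
    have H: "H \<in> \<S> \<and> verts H = {..<k}" using that by simp
    obtain I l where "maximum_independent_set H I" "runs p (enc_graph k H) (enc_set k I) l" "l \<le> T2 k"
      using p[THEN spec, THEN spec, THEN mp, OF H] by (elim exE conjE)
    then have "\<exists>I. maximum_independent_set H I \<and> (\<exists>l\<le>T2 k. runs p (enc_graph k H) (enc_set k I) l)"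
      by (intro exI conjI)
    from someI_ex[OF this] show "maximum_independent_set H (m k H)"
      "\<exists>l\<le>T2 k. runs p (enc_graph k H) (enc_set k (m k H)) l"
      unfolding m_def by (rule conjunct1, rule conjunct2)
  qed
  have mis: "computes {(k, H). H \<in> \<S> \<and> verts H = {..<k}} (\<lambda>p. enc_graph (fst p) (snd p))
      (\<lambda>p. enc_set (fst p) (m (fst p) (snd p))) (\<lambda>p. T2 (fst p))"
  proof (rule runs_computes[where p = p])
    fix q assume "q \<in> {(k, H). H \<in> \<S> \<and> verts H = {..<k}}"
    then have "snd q \<in> \<S>" "verts (snd q) = {..<fst q}" by (simp_all add: split_beta)
    then show "\<exists>l\<le>T2 (fst q). runs p (enc_graph (fst q) (snd q)) (enc_set (fst q) (m (fst q) (snd q))) l"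
      by (rule m(2))
  qed
  define S where "S G = search \<S> G (Ws G) (n G)" for G
  have Ws_sub: "W \<subseteq> {..<n G}" if "W \<in> set (Ws G)" for G W
    using that set_small_sets unfolding Ws_def by blast
  have Ws_complete: "W \<in> set (Ws G)" if "W \<subseteq> {..<n G}" "W \<noteq> {}" "card W \<le> M" for G W
    unfolding Ws_def using that by (rule small_sets_complete)
  have SG: "S G \<subseteq> {..<n G}" "induced G (S G) \<in> \<S>" "maximum_independent_set G (best_candidate m (n G) G (S G) (Ws G))"
    if GA: "G \<in> A" for G
  proof -
    obtain P Q where part: "sparse_dense_partition \<S> \<D> G P Q"
      using GA by (auto simp: A_def sparse_dense_graphs_def)
    then have "P \<subseteq> {..<n G}" unfolding G(2)[OF GA, symmetric] by (auto simp: sparse_dense_partition_def)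
    have sub: "\<forall>W\<in>set (Ws G). W \<subseteq> verts G"
      unfolding G(2)[OF GA] using Ws_sub by (intro ballI)
    have complete: "W \<in> set (Ws G)" if "W \<subseteq> verts G" "W \<noteq> {}" "card W \<le> M" for W
      using Ws_complete[OF _ that(2,3)] that(1) unfolding G(2)[OF GA] .
    from \<open>P \<subseteq> {..<n G}\<close> have "card P \<le> n G" using card_mono[of "{..<n G}" P] by simp
    moreover have "S G \<subseteq> verts G \<and> induced G (S G) \<in> \<S> \<and> min (n G) (card P) \<le> card (S G)"
      unfolding S_def
    proof (rule search_props[OF classes G(1)[OF GA] part])
      show "W \<in> set (Ws G)" if "W \<subseteq> verts G" "W \<noteq> {}" "card W \<le> 2 * c + 1" for W
        by (rule complete[OF that(1,2)]) (use that(3) in \<open>simp add: M_def\<close>)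
    qed (rule sub)
    ultimately have S: "S G \<subseteq> verts G" "induced G (S G) \<in> \<S>" "card P \<le> card (S G)" by auto
    then show "S G \<subseteq> {..<n G}" "induced G (S G) \<in> \<S>" using G(2)[OF GA] by auto
    show "maximum_independent_set G (best_candidate m (n G) G (S G) (Ws G))"
    proof (rule best_candidate_maximum[OF classes D \<open>t > 0\<close> G[OF GA] part S])
      show "W \<in> set (Ws G)" if "W \<subseteq> verts G" "W \<noteq> {}" "card W \<le> c + t" for W
        by (rule complete[OF that(1,2)]) (use that(3) in \<open>simp add: M_def\<close>)
    qed (rule m(1), assumption+, rule sub)
  qed
  let ?g = "\<lambda>G. enc_graph (n G) G"
  have "computes A ?g (\<lambda>G. enc_list (map (row (n G) G) [0..<n G])) T"
    using computes_id[of A T ?g] nT(2) by (simp add: enc_graph_rows)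
  then have "computes A ?g (\<lambda>G. enc_list (map (\<lambda>v. enc_set (n G) {v}) [0..<n G])) T"
    by (rule computes_singletons) (rule nT(1))
  then have Ws: "computes A ?g (\<lambda>G. enc_list (map (enc_set (n G)) (Ws G))) T"
    unfolding Ws_def by (rule computes_apply[OF computes_small_sets, where \<phi> = n and C = 1]) (rule UNIV_I, rule Tpow, simp)
  have search: "computes A (\<lambda>G. Dot (enc_list (map (enc_set (n G)) (Ws G))) (?g G)) (\<lambda>G. enc_set (n G) (S G)) T"
    unfolding S_def by (rule computes_search[OF T1 \<S>(1) G Ws_sub U(1,3) TU])
  \<comment> \<open>The environment grows from the graph to the list of sets and then to the sparse
    set found by the search, in the order that \<open>computes_best_candidate\<close>
    expects.\<close>
  have "computes A ?g (\<lambda>G. enc_set (n G) (best_candidate m (n G) G (S G) (Ws G))) T"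
    by (rule computes_let[OF Ws], rule computes_let[OF search],
      rule computes_best_candidate[OF \<S> mis T2(2) m(1) G SG(1,2) Ws_sub U(2,3) UT])
  from computes_runs[OF this] obtain q K where q: "\<forall>G\<in>A. \<exists>k\<le>K * T G.
      runs q (?g G) (enc_set (n G) (best_candidate m (n G) G (S G) (Ws G))) k"
    by blast
  have "mis_computable_in_time (sparse_dense_graphs \<S> \<D>) (\<lambda>n. K * ((T1 n + T2 n) * Suc n ^ (M + 3)))"
    unfolding mis_computable_in_time_def
  proof (intro exI[of _ q] allI impI)
    fix k G assume "G \<in> sparse_dense_graphs \<S> \<D> \<and> verts G = {..<k}"
    then have GA: "G \<in> A" and k: "n G = k" by (auto simp: A_def n_def)
    show "\<exists>I l. maximum_independent_set G I \<and> runs q (enc_graph k G) (enc_set k I) l \<and>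
        l \<le> K * ((T1 k + T2 k) * Suc k ^ (M + 3))"
      using q[rule_format, OF GA] SG(3)[OF GA] unfolding k T_def by blast
  qed
  then show ?thesis by (auto simp: M_def add.commute add.left_commute)
qed

theorem theorem7:
  fixes c :: nat
  shows "\<exists>C::nat. \<forall>(\<S>::ugraph set) (\<D>::ugraph set) (T\<^sub>1::nat \<Rightarrow> nat) (T\<^sub>2::nat \<Rightarrow> nat).
     sparse_dense_classes c \<S> \<D> \<and> mono T\<^sub>1 \<and> mono T\<^sub>2 \<and>
     recognizable_in_time \<S> T\<^sub>1 \<and> mis_computable_in_time \<S> T\<^sub>2 \<longrightarrow>
     (\<exists>K::nat. \<forall>t::nat. \<D> \<subseteq> co_clique_free t \<longrightarrow>
        (\<exists>T::nat \<Rightarrow> nat. mis_computable_in_time (sparse_dense_graphs \<S> \<D>) T \<and>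
           (\<forall>n\<ge>1. T n \<le> K * (T\<^sub>1 n + T\<^sub>2 n) * n ^ (C * t))))"
proof (rule exI[of _ "2 * c + 5"], intro allI impI)
  fix \<S> \<D> :: "ugraph set" and T1 T2 :: "nat \<Rightarrow> nat"
  assume asm: "sparse_dense_classes c \<S> \<D> \<and> mono T1 \<and> mono T2 \<and>
    recognizable_in_time \<S> T1 \<and> mis_computable_in_time \<S> T2"
  let ?goal = "\<lambda>K t. \<exists>T. mis_computable_in_time (sparse_dense_graphs \<S> \<D>) T \<and>
    (\<forall>n\<ge>1. T n \<le> K * (T1 n + T2 n) * n ^ ((2 * c + 5) * t))"
  show "\<exists>K. \<forall>t. \<D> \<subseteq> co_clique_free t \<longrightarrow> ?goal K t"
  proof (cases "\<exists>t. \<D> \<subseteq> co_clique_free t")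
    case True
    \<comment> \<open>\<open>K\<close> is chosen after the classes but before \<open>t\<close>, so
      it may depend on the least admissible value \<open>s\<close>.\<close>
    define s where "s = (LEAST t. \<D> \<subseteq> co_clique_free t)"
    have s: "\<D> \<subseteq> co_clique_free s" using True unfolding s_def by (rule LeastI_ex)
    have le: "s \<le> t" if "\<D> \<subseteq> co_clique_free t" for t
      unfolding s_def using that by (rule Least_le)
    show ?thesis
    proof (cases "s = 0")
      case True
      \<comment> \<open>With \<open>t = 0\<close> the exponent is 0. But the empty set is an
        independent set of size 0 in every graph, so the dense class is empty, and with it the class
        of sparse-dense graphs.\<close>
      have "co_clique_free 0 = {}"
        unfolding co_clique_free_def by (auto simp: independent_set_def intro!: exI[of _ "{}"])
      with s True have "\<D> = {}" by simp
      then have "sparse_dense_graphs \<S> \<D> = {}"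
        by (auto simp: sparse_dense_graphs_def sparse_dense_partition_def)
      then have "mis_computable_in_time (sparse_dense_graphs \<S> \<D>) (\<lambda>_. 0)"
        by (simp add: mis_computable_in_time_def)
      then show ?thesis by (intro exI[of _ 0] allI impI exI[of _ "\<lambda>_. 0"]) simp
    next
      case False
      let ?e = "2 * c + s + 4"
      obtain K where K: "mis_computable_in_time (sparse_dense_graphs \<S> \<D>)
          (\<lambda>n. K * ((T1 n + T2 n) * Suc n ^ ?e))"
        using sparse_dense_mis_computable[of c \<S> \<D> s T1 T2] asm s False by auto
      have "K * ((T1 n + T2 n) * Suc n ^ ?e) \<le> K * 2 ^ ?e * (T1 n + T2 n) * n ^ ((2 * c + 5) * t)"
        if "n \<ge> 1" "\<D> \<subseteq> co_clique_free t" for n t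
      proof -
        have t: "t \<ge> 1" "t \<ge> s" using le[OF that(2)] False by auto
        \<comment> \<open>This fixes the constant \<open>2 * c + 5\<close>: \<open>t >= 1\<close>
          absorbs the summand \<open>2 * c + 4\<close>, and \<open>t >= s\<close> absorbs
          \<open>s\<close>.\<close>
        have "?e \<le> (2 * c + 4) * 1 + s" by simp
        also have "\<dots> \<le> (2 * c + 4) * t + t" using t by (intro add_mono mult_le_mono2)
        also have "\<dots> = (2 * c + 5) * t" by (simp add: algebra_simps)
        finally have "n ^ ?e \<le> n ^ ((2 * c + 5) * t)" using that(1) by (rule power_increasing)
        \<comment> \<open>From \<open>n >= 1\<close> follows \<open>Suc n <= 2 * n\<close>. The
          power of 2 goes into the constant; its exponent depends on \<open>c\<close> and
          \<open>s\<close>, not on \<open>t\<close>.\<close>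
        moreover have "Suc n ^ ?e \<le> (2 * n) ^ ?e" using that(1) by (intro power_mono) auto
        ultimately have "Suc n ^ ?e \<le> 2 ^ ?e * n ^ ((2 * c + 5) * t)"
          unfolding power_mult_distrib by (meson le_trans mult_le_mono2)
        then have "K * ((T1 n + T2 n) * Suc n ^ ?e)
            \<le> K * ((T1 n + T2 n) * (2 ^ ?e * n ^ ((2 * c + 5) * t)))"
          by (intro mult_le_mono2)
        then show ?thesis by (simp only: mult_ac)
      qed
      with K show ?thesis
        by (intro exI[of _ "K * 2 ^ ?e"] allI impI exI[of _ "\<lambda>n. K * ((T1 n + T2 n) * Suc n ^ ?e)"] conjI) auto
    qed
  qed blast
qed

end
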